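(* Every closed nonreflexive subspace of an M-embedded Banach space fails the fixed point property.
   Context: Banach spaces are over the complex field (the result also holds for real Banach spaces). A Banach space $X$ is regarded as a subspace of its bidual $X''$ via the canonical embedding. A projection $P$ on a Banach space $Z$ is an L-projection if $\|z\| = \|Pz\| + \|z-Pz\|$ for all $z\in Z$. A subspace $Y$ of a Banach space $Z$ is an M-ideal in $Z$ if its annihilator $Y^\bot$ in the dual $Z'$ is the range of an L-projection on $Z'$. A Banach space $X$ is M-embedded if $X$ is an M-ideal in $X''$. A Banach space $X$ has the fixed point property if every contractive (not necessarily linear) map $f: C\to C$ on any non-empty closed bounded convex subset $C\subset X$ has a fixed point, where contractive means $\|f(x)-f(y)\|<\|x-y\|$ for all $x,y\in C$ with $x\ne y$. *)

theory Defs
  imports "HOL-Analysis.Analysis" "HOL-Library.Function_Algebras"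
begin

subsection \<open>Complex Banach spaces\<close>

class complex_vector = ab_group_add +
  fixes scaleC :: "complex \<Rightarrow> 'a \<Rightarrow> 'a"  (infixr \<open>*\<^sub>C\<close> 75)
  assumes scaleC_add_right: "a *\<^sub>C (x + y) = a *\<^sub>C x + a *\<^sub>C y"
    and scaleC_add_left: "(a + b) *\<^sub>C x = a *\<^sub>C x + b *\<^sub>C x"
    and scaleC_scaleC: "a *\<^sub>C b *\<^sub>C x = (a * b) *\<^sub>C x"
    and scaleC_one: "1 *\<^sub>C x = x"

global_interpretation complex_vector: vector_space "scaleC :: complex \<Rightarrow> 'a \<Rightarrow> 'a::complex_vector"
  by unfold_locales (simp_all add: scaleC_add_right scaleC_add_left scaleC_scaleC scaleC_one)

abbreviation csubspace :: "'a::complex_vector set \<Rightarrow> bool"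
  where "csubspace \<equiv> complex_vector.subspace"

class complex_normed_vector = complex_vector + real_normed_vector +
  assumes scaleR_scaleC: "r *\<^sub>R x = complex_of_real r *\<^sub>C x"
    and norm_scaleC: "norm (a *\<^sub>C x) = cmod a * norm x"

class complex_banach = complex_normed_vector + complete_space

subclass (in complex_banach) banach ..

instantiation complex :: complex_banach
begin
definition "a *\<^sub>C (x::complex) = a * x"
instance
  by standard (auto simp: scaleC_complex_def algebra_simps scaleR_conv_of_real norm_mult)
end

instantiation "fun" :: (type, complex_vector) complex_vector
begin
definition "a *\<^sub>C f = (\<lambda>x. a *\<^sub>C f x)"
instance
  by standard (auto simp: scaleC_fun_def plus_fun_def scaleC_add_right scaleC_add_left
      scaleC_scaleC scaleC_one)
end

subsection \<open>Normed spaces as carriers, duals and biduals\<close>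

text \<open>
  In order to treat a Banach space, its subspaces and its iterated duals uniformly, a complex normed
  space is given by a linear subspace \<open>V\<close> of a type of class \<open>complex_vector\<close> and a norm \<open>N\<close>, only
  the values of which on \<open>V\<close> matter. A functional on \<open>V\<close> is represented by a function that
  vanishes outside \<open>V\<close>, so that equality in the dual is equality of functions and the dual is again
  a linear subspace of a type of class \<open>complex_vector\<close>.
\<close>

definition clinear_on :: "'v::complex_vector set \<Rightarrow> ('v \<Rightarrow> 'w::complex_vector) \<Rightarrow> bool" where
  "clinear_on V f \<longleftrightarrow>
     (\<forall>x\<in>V. \<forall>y\<in>V. f (x + y) = f x + f y) \<and> (\<forall>a. \<forall>x\<in>V. f (a *\<^sub>C x) = a *\<^sub>C f x)"

definition dual :: "'v::complex_vector set \<Rightarrow> ('v \<Rightarrow> real) \<Rightarrow> ('v \<Rightarrow> complex) set" where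
  "dual V N = {f. clinear_on V f \<and> (\<exists>B. \<forall>x\<in>V. cmod (f x) \<le> B * N x) \<and> (\<forall>x. x \<notin> V \<longrightarrow> f x = 0)}"

definition dual_norm :: "'v::complex_vector set \<Rightarrow> ('v \<Rightarrow> real) \<Rightarrow> ('v \<Rightarrow> complex) \<Rightarrow> real" where
  "dual_norm V N f = (SUP x\<in>{x\<in>V. N x \<le> 1}. cmod (f x))"

definition bidual ::
  "'v::complex_vector set \<Rightarrow> ('v \<Rightarrow> real) \<Rightarrow> (('v \<Rightarrow> complex) \<Rightarrow> complex) set" where
  "bidual V N = dual (dual V N) (dual_norm V N)"

definition bidual_norm ::
  "'v::complex_vector set \<Rightarrow> ('v \<Rightarrow> real) \<Rightarrow> (('v \<Rightarrow> complex) \<Rightarrow> complex) \<Rightarrow> real" where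
  "bidual_norm V N = dual_norm (dual V N) (dual_norm V N)"

definition canonical_embedding ::
  "'v::complex_vector set \<Rightarrow> ('v \<Rightarrow> real) \<Rightarrow> 'v \<Rightarrow> (('v \<Rightarrow> complex) \<Rightarrow> complex)" where
  "canonical_embedding V N x = (\<lambda>f. if f \<in> dual V N then f x else 0)"

definition reflexive :: "'v::complex_vector set \<Rightarrow> ('v \<Rightarrow> real) \<Rightarrow> bool" where
  "reflexive V N \<longleftrightarrow> canonical_embedding V N ` V = bidual V N"

subsection \<open>L-projections, M-ideals and M-embedded spaces\<close>

definition L_projection :: "'z::complex_vector set \<Rightarrow> ('z \<Rightarrow> real) \<Rightarrow> ('z \<Rightarrow> 'z) \<Rightarrow> bool" where
  "L_projection Z N P \<longleftrightarrow>
     P \<in> Z \<rightarrow> Z \<and> clinear_on Z P \<and> (\<forall>z\<in>Z. P (P z) = P z) \<and> (\<forall>z\<in>Z. N z = N (P z) + N (z - P z))"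

definition annihilator ::
  "'z::complex_vector set \<Rightarrow> ('z \<Rightarrow> real) \<Rightarrow> 'z set \<Rightarrow> ('z \<Rightarrow> complex) set" where
  "annihilator Z N Y = {f \<in> dual Z N. \<forall>y\<in>Y. f y = 0}"

definition M_ideal :: "'z::complex_vector set \<Rightarrow> ('z \<Rightarrow> real) \<Rightarrow> 'z set \<Rightarrow> bool" where
  "M_ideal Z N Y \<longleftrightarrow> csubspace Y \<and> Y \<subseteq> Z \<and>
     (\<exists>P. L_projection (dual Z N) (dual_norm Z N) P \<and> P ` dual Z N = annihilator Z N Y)"

definition M_embedded :: "'v::complex_vector set \<Rightarrow> ('v \<Rightarrow> real) \<Rightarrow> bool" where
  "M_embedded X N \<longleftrightarrow> M_ideal (bidual X N) (bidual_norm X N) (canonical_embedding X N ` X)"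

subsection \<open>The fixed point property\<close>

definition contractive_on :: "'a::complex_normed_vector set \<Rightarrow> ('a \<Rightarrow> 'a) \<Rightarrow> bool" where
  "contractive_on C f \<longleftrightarrow> (\<forall>x\<in>C. \<forall>y\<in>C. x \<noteq> y \<longrightarrow> norm (f x - f y) < norm (x - y))"

definition fixed_point_property :: "'a::complex_banach set \<Rightarrow> bool" where
  "fixed_point_property X \<longleftrightarrow>
     (\<forall>C f. C \<subseteq> X \<and> C \<noteq> {} \<and> closed C \<and> bounded C \<and> convex C \<and> f \<in> C \<rightarrow> C \<and> contractive_on C f
        \<longrightarrow> (\<exists>x\<in>C. f x = x))"

subsection \<open>Well-formedness\<close>

lemma csubspace_dual: "csubspace (dual V N)"
proof (rule complex_vector.subspaceI)
  show "0 \<in> dual V N"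
    by (auto simp: dual_def clinear_on_def scaleC_complex_def intro: exI[of _ 0])
next
  fix f g assume f: "f \<in> dual V N" and g: "g \<in> dual V N"
  obtain B where B: "\<And>x. x \<in> V \<Longrightarrow> cmod (f x) \<le> B * N x"
    using f by (auto simp: dual_def)
  obtain B' where B': "\<And>x. x \<in> V \<Longrightarrow> cmod (g x) \<le> B' * N x"
    using g by (auto simp: dual_def)
  have "cmod (f x + g x) \<le> (B + B') * N x" if "x \<in> V" for x
    using B[OF that] B'[OF that] norm_triangle_ineq[of "f x" "g x"] by (simp add: algebra_simps)
  then have "\<exists>B. \<forall>x\<in>V. cmod ((f + g) x) \<le> B * N x"
    by (intro exI[of _ "B + B'"]) simp
  then show "f + g \<in> dual V N"
    using f g by (auto simp: dual_def clinear_on_def scaleC_complex_def ring_distribs)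
next
  fix a f assume f: "f \<in> dual V N"
  obtain B where B: "\<And>x. x \<in> V \<Longrightarrow> cmod (f x) \<le> B * N x"
    using f by (auto simp: dual_def)
  have "cmod (a * f x) \<le> (cmod a * B) * N x" if "x \<in> V" for x
    using B[OF that] by (simp add: norm_mult mult.assoc mult_left_mono)
  then have "\<exists>B. \<forall>x\<in>V. cmod ((a *\<^sub>C f) x) \<le> B * N x"
    by (intro exI[of _ "cmod a * B"]) (simp add: scaleC_fun_def scaleC_complex_def)
  then show "a *\<^sub>C f \<in> dual V N"
    using f by (auto simp: dual_def clinear_on_def scaleC_complex_def scaleC_fun_def algebra_simps)
qed

lemma dual_norm_bound:
  assumes "f \<in> dual V N" "x \<in> V" "N x \<le> 1" "\<And>x. x \<in> V \<Longrightarrow> 0 \<le> N x"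
  shows "cmod (f x) \<le> dual_norm V N f"
proof -
  obtain B where B: "\<And>x. x \<in> V \<Longrightarrow> cmod (f x) \<le> B * N x"
    using assms(1) by (auto simp: dual_def)
  have "cmod (f y) \<le> \<bar>B\<bar>" if "y \<in> V" "N y \<le> 1" for y
  proof -
    have "B * N y \<le> \<bar>B\<bar> * N y"
      using assms(4)[OF that(1)] by (intro mult_right_mono) auto
    also have "\<dots> \<le> \<bar>B\<bar>"
      using that by (simp add: mult_left_le)
    finally show ?thesis using B[OF that(1)] by simp
  qed
  then have "bdd_above ((\<lambda>x. cmod (f x)) ` {x\<in>V. N x \<le> 1})"
    by (auto intro!: bdd_aboveI[of _ "\<bar>B\<bar>"])
  then show ?thesis
    unfolding dual_norm_def using assms(2,3) by (intro cSUP_upper) auto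
qed

lemma canonical_embedding_in_bidual:
  assumes V: "csubspace V" and x: "x \<in> V"
    and nonneg: "\<And>x. x \<in> V \<Longrightarrow> 0 \<le> N x"
    and definite: "\<And>x. x \<in> V \<Longrightarrow> N x = 0 \<Longrightarrow> x = 0"
    and homogeneous: "\<And>a x. x \<in> V \<Longrightarrow> N (a *\<^sub>C x) = cmod a * N x"
  shows "canonical_embedding V N x \<in> bidual V N"
proof -
  have "cmod (f x) \<le> N x * dual_norm V N f" if f: "f \<in> dual V N" for f
  proof (cases "N x = 0")
    case True
    then obtain B where "cmod (f x) \<le> B * N x" using f x by (auto simp: dual_def)
    then show ?thesis using True by simp
  next
    case False
    then have pos: "N x > 0" using nonneg[OF x] by simp
    let ?y = "complex_of_real (1 / N x) *\<^sub>C x"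
    have y: "?y \<in> V" using V x by (rule complex_vector.subspace_scale)
    have "N ?y \<le> 1" using pos by (simp add: homogeneous[OF x] norm_divide)
    then have "cmod (f ?y) \<le> dual_norm V N f"
      using dual_norm_bound[OF f y] nonneg by blast
    moreover have "f ?y = complex_of_real (1 / N x) * f x"
      using f x by (auto simp: dual_def clinear_on_def scaleC_complex_def)
    then have "cmod (f ?y) = cmod (f x) / N x"
      using pos by (simp only: norm_mult) (simp add: norm_divide)
    ultimately have "cmod (f x) / N x \<le> dual_norm V N f" by simp
    then show ?thesis
      using pos by (simp add: field_simps)
  qed
  moreover have "f + g \<in> dual V N" "a *\<^sub>C f \<in> dual V N" if "f \<in> dual V N" "g \<in> dual V N" for a f g
    using that csubspace_dual complex_vector.subspace_add complex_vector.subspace_scale by blast+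
  ultimately show ?thesis
    unfolding bidual_def dual_def[of "dual V N"] clinear_on_def canonical_embedding_def
    by (auto simp: scaleC_fun_def)
qed

end

theory Submission imports Defs begin

text \<open>
  Let \<open>\<theta>\<close> be an element of \<open>Y\<^sup>\<bottom>\<^sup>\<bottom> \<subseteq> X''\<close> outside \<open>Y\<close>, scaled so that its norm and its distance
  to \<open>Y\<close> are both close to \<open>1\<close>. M-embeddedness gives \<open>X''' = X' \<oplus>\<^sub>1 X\<^sup>\<bottom>\<close>; by Hahn-Banach duality in
  finite powers of \<open>X''\<close>, for finitely many \<open>e \<in> Y\<close> of norm less than \<open>1\<close> some \<open>w \<in> \<theta> + Y\<close> satisfies
  \<open>\<parallel>e + w\<parallel> < 1\<close> for all of them, and Helly's theorem replaces \<open>w\<close> by an element of \<open>Y\<close> of norm close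
  to \<open>1\<close>. Iterating over sign combinations yields \<open>x\<^sub>n \<in> Y\<close> with
  \<open>sup b\<^sub>n \<bar>t\<^sub>n\<bar> \<le> \<parallel>\<Sum> t\<^sub>n x\<^sub>n\<parallel> \<le> sup \<bar>t\<^sub>n\<bar>\<close> for real null sequences \<open>t\<close>, where \<open>b\<^sub>n \<rightarrow> 1\<close> as fast as
  desired. On the closed convex set of all \<open>\<Sum> t\<^sub>n x\<^sub>n\<close> with \<open>0 \<le> t\<^sub>n \<le> 1\<close> the weighted shift
  \<open>(t\<^sub>0, t\<^sub>1, \<dots>) \<mapsto> (1, c\<^sub>0 t\<^sub>0, c\<^sub>1 t\<^sub>1, \<dots>)\<close> with \<open>c\<^sub>n < b\<^sub>n\<close> and \<open>\<Prod> c\<^sub>n > 0\<close> is contractive, and the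
  coefficients of a fixed point would not tend to \<open>0\<close>.
\<close>

subsection \<open>The Hahn-Banach theorem on a carrier\<close>

text \<open>M-embeddedness is assumed for X only, while the blocks must lie in Y, and adding a block
  must not push any of finitely many norms up to 1. One cancellation settles both. A dual tuple
  (\<Phi>_e) whose sum vanishes on Y splits as \<Phi>_e = g_e + v_e with g_e in X' and v_e in the
  annihilator of X. The sum of the g_e annihilates Y, so the terms \<theta>(g_e) add up to 0; what
  remains is g_e(e) + v_e(\<theta>). Since the norms of g_e and v_e add, this is controlled by the
  maximum of the norms of e and \<theta> instead of their sum. The distance of \<theta> to Y matters
  because it is the lower bound that survives translation by Y. Real coefficients suffice because
  the fixed point property involves only the real convex structure. The shift cannot be a uniform
  contraction, since such a map of a closed set has a fixed point; its weights tend to 1, and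
  strictness comes from a null sequence attaining its maximum, at an index where c_n < b_n.\<close>

definition sublinear_on :: "'v::complex_vector set \<Rightarrow> ('v \<Rightarrow> real) \<Rightarrow> bool" where
  "sublinear_on V p \<longleftrightarrow> p 0 = 0 \<and> (\<forall>x\<in>V. \<forall>y\<in>V. p (x + y) \<le> p x + p y) \<and>
     (\<forall>t>0. \<forall>x\<in>V. p (complex_of_real t *\<^sub>C x) \<le> t * p x)"

definition real_linear_on :: "'v::complex_vector set \<Rightarrow> ('v \<Rightarrow> real) \<Rightarrow> bool" where
  "real_linear_on V F \<longleftrightarrow> (\<forall>x\<in>V. \<forall>y\<in>V. F (x + y) = F x + F y) \<and>
     (\<forall>t. \<forall>x\<in>V. F (complex_of_real t *\<^sub>C x) = t * F x)"

lemma sublinear_on_cong: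
  assumes "csubspace V" "sublinear_on V p" "\<And>x. x \<in> V \<Longrightarrow> q x = p x"
  shows "sublinear_on V q"
  using assms complex_vector.subspace_0 complex_vector.subspace_add complex_vector.subspace_scale
  unfolding sublinear_on_def by (auto simp: complex_vector.subspace_def)

lemma sublinear_on_lower:
  assumes V: "csubspace V" and p: "sublinear_on V p" and x: "x \<in> V"
  shows "- p (- x) \<le> p x"
proof -
  have "p (x + - x) \<le> p x + p (- x)"
    using p x complex_vector.subspace_neg[OF V x] unfolding sublinear_on_def by blast
  then show ?thesis using p by (simp add: sublinear_on_def)
qed

text \<open>A convex cone of demands \<open>c \<le> F s\<close> on a functional \<open>F\<close>
  below \<open>p\<close>; \<open>c \<le> p s\<close> is the compatibility condition. Rays give
  functionals that attain \<open>p\<close> at a point, subspaces with \<open>c = 0\<close> give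
  annihilators, and the graph of \<open>Re f\<close> gives extensions.\<close>

definition cone_below :: "'v::complex_vector set \<Rightarrow> ('v \<Rightarrow> real) \<Rightarrow> ('v \<times> real) set \<Rightarrow> bool" where
  "cone_below V p G \<longleftrightarrow> (0, 0) \<in> G \<and> (\<forall>s c. (s, c) \<in> G \<longrightarrow> s \<in> V \<and> c \<le> p s) \<and>
     (\<forall>s c s' c'. (s, c) \<in> G \<longrightarrow> (s', c') \<in> G \<longrightarrow> (s + s', c + c') \<in> G) \<and>
     (\<forall>t>0. \<forall>s c. (s, c) \<in> G \<longrightarrow> (complex_of_real t *\<^sub>C s, t * c) \<in> G)"

text \<open>This lowers \<open>p\<close> just enough: \<open>q (- s) \<le> p 0 - c = - c\<close>, so
  every linear functional below \<open>q\<close> meets all demands. The infimum is finite because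
  \<open>c \<le> p s\<close> yields the lower bound \<open>- p (- x)\<close>.\<close>

lemma sublinear_on_cone_infimum:
  fixes G :: "('v::complex_vector \<times> real) set"
  assumes V: "csubspace V" and p: "sublinear_on V p"
    and cone: "cone_below V p G"
  defines "q \<equiv> \<lambda>x. INF z\<in>G. p (x + fst z) - snd z"
  shows "sublinear_on V q"
    and "\<And>x. x \<in> V \<Longrightarrow> q x \<le> p x"
    and "\<And>s c. (s, c) \<in> G \<Longrightarrow> q (- s) \<le> - c"
proof -
  note V_add = complex_vector.subspace_add[OF V]
  note V_neg = complex_vector.subspace_neg[OF V]
  note V_0 = complex_vector.subspace_0[OF V]
  note V_scale = complex_vector.subspace_scale[OF V]
  have G: "\<And>s c. (s, c) \<in> G \<Longrightarrow> s \<in> V \<and> c \<le> p s" and G0: "(0, 0) \<in> G"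
    and Gadd: "\<And>s c s' c'. (s, c) \<in> G \<Longrightarrow> (s', c') \<in> G \<Longrightarrow> (s + s', c + c') \<in> G"
    and Gscale: "\<And>s c t. (s, c) \<in> G \<Longrightarrow> t > 0 \<Longrightarrow> (complex_of_real t *\<^sub>C s, t * c) \<in> G"
    using cone unfolding cone_below_def by blast+
  have p0: "p 0 = 0" and padd: "\<And>x y. x \<in> V \<Longrightarrow> y \<in> V \<Longrightarrow> p (x + y) \<le> p x + p y"
    and pscale: "\<And>t x. t > 0 \<Longrightarrow> x \<in> V \<Longrightarrow> p (complex_of_real t *\<^sub>C x) \<le> t * p x"
    using p by (auto simp: sublinear_on_def)
  have low: "- p (- x) \<le> p (x + s) - c" if "x \<in> V" "(s, c) \<in> G" for x s c
  proof -
    have "p ((x + s) + - x) \<le> p (x + s) + p (- x)"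
      using that G V_add V_neg by (intro padd) auto
    moreover have "c \<le> p s" using G that by blast
    ultimately show ?thesis by (simp add: algebra_simps)
  qed
  have up: "q x \<le> p (x + s) - c" if "x \<in> V" "(s, c) \<in> G" for x s c
  proof -
    have "bdd_below ((\<lambda>z. p (x + fst z) - snd z) ` G)"
      using low[OF that(1)] by (auto intro!: bdd_belowI[of _ "- p (- x)"])
    then show ?thesis unfolding q_def using that(2) by (rule cINF_lower2) simp
  qed
  have greatest: "m \<le> q x" if "\<And>s c. (s, c) \<in> G \<Longrightarrow> m \<le> p (x + s) - c" for m x
    unfolding q_def using G0 that by (intro cINF_greatest) auto
  show le: "q x \<le> p x" if "x \<in> V" for x using up[OF that G0] by simp
  show "q (- s) \<le> - c" if "(s, c) \<in> G" for s c
  proof -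
    have "q (- s) \<le> p (- s + s) - c" using G[OF that] V_neg that by (intro up) auto
    then show ?thesis using p0 by simp
  qed
  have "q 0 = 0"
    using le[OF V_0] greatest[of 0 0] low[OF V_0] p0 by force
  moreover have "q (x + y) \<le> q x + q y" if x: "x \<in> V" and y: "y \<in> V" for x y
  proof -
    have *: "q (x + y) \<le> (p (x + s) - c) + (p (y + s') - c')"
      if z: "(s, c) \<in> G" and z': "(s', c') \<in> G" for s c s' c'
    proof -
      have "q (x + y) \<le> p ((x + y) + (s + s')) - (c + c')"
        using x y Gadd[OF z z'] V_add by (intro up) auto
      also have "p ((x + y) + (s + s')) \<le> p (x + s) + p (y + s')"
        using padd[of "x + s" "y + s'"] x y G[OF z] G[OF z'] V_add by (simp add: add_ac)
      finally show ?thesis by simp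
    qed
    have "q (x + y) - (p (y + s') - c') \<le> q x" if z': "(s', c') \<in> G" for s' c'
    proof (rule greatest)
      fix s c assume "(s, c) \<in> G"
      from *[OF this z'] show "q (x + y) - (p (y + s') - c') \<le> p (x + s) - c" by simp
    qed
    then have "q (x + y) - q x \<le> q y"
      by (intro greatest) (force simp: algebra_simps)
    then show ?thesis by simp
  qed
  moreover have "q (complex_of_real t *\<^sub>C x) \<le> t * q x" if t: "t > 0" and x: "x \<in> V" for t x
  proof -
    have "q (complex_of_real t *\<^sub>C x) / t \<le> q x"
    proof (rule greatest)
      fix s c assume z: "(s, c) \<in> G"
      have "q (complex_of_real t *\<^sub>C x)
          \<le> p (complex_of_real t *\<^sub>C x + complex_of_real t *\<^sub>C s) - t * c"
        using x z Gscale[OF z t] V_scale by (intro up) auto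
      also have "\<dots> \<le> t * p (x + s) - t * c"
        using pscale[OF t, of "x + s"] x G[OF z] V_add by (simp add: scaleC_add_right)
      finally show "q (complex_of_real t *\<^sub>C x) / t \<le> p (x + s) - c"
        using t by (simp add: field_simps)
    qed
    then show ?thesis using t by (simp add: field_simps)
  qed
  ultimately show "sublinear_on V q" by (auto simp: sublinear_on_def)
qed

text \<open>Supplies the bounds of chains in Zorn's lemma. Subadditivity needs comparability: the
  smaller of \<open>q\<close> and \<open>r\<close> serves for both summands at once.\<close>

lemma sublinear_on_chain_infimum:
  assumes V: "csubspace V" and C: "C \<noteq> {}"
    and C_sub: "\<forall>q\<in>C. sublinear_on V q \<and> (\<forall>x\<in>V. q x \<le> p x)"
    and C_chain: "\<forall>q\<in>C. \<forall>r\<in>C. (\<forall>x. q x \<le> r x) \<or> (\<forall>x. r x \<le> q x)"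
  shows "sublinear_on V (\<lambda>x. INF q\<in>C. q x)"
    and "\<And>q x. q \<in> C \<Longrightarrow> x \<in> V \<Longrightarrow> (INF q\<in>C. q x) \<le> q x"
proof -
  have sub: "\<And>q. q \<in> C \<Longrightarrow> sublinear_on V q"
    and le: "\<And>q x. q \<in> C \<Longrightarrow> x \<in> V \<Longrightarrow> q x \<le> p x"
    and chain: "\<And>q r. q \<in> C \<Longrightarrow> r \<in> C \<Longrightarrow> (\<forall>x. q x \<le> r x) \<or> (\<forall>x. r x \<le> q x)"
    using C_sub C_chain by blast+
  have low: "- p (- x) \<le> q x" if "q \<in> C" "x \<in> V" for q x
    using sublinear_on_lower[OF V sub] le that complex_vector.subspace_neg[OF V] by force
  show lower: "(INF q\<in>C. q x) \<le> q x" if "q \<in> C" "x \<in> V" for q x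
    using that low[OF _ that(2)] by (intro cINF_lower) (auto intro!: bdd_belowI[of _ "- p (- x)"])
  have greatest: "m \<le> (INF q\<in>C. q x)" if "\<And>q. q \<in> C \<Longrightarrow> m \<le> q x" for m x
    using C that by (intro cINF_greatest) auto
  have "(INF q\<in>C. q 0) = 0"
  proof -
    have "(\<lambda>q. q 0) ` C = {0}" using C sub by (force simp: sublinear_on_def)
    then show ?thesis by simp
  qed
  moreover have "(INF q\<in>C. q (x + y)) \<le> (INF q\<in>C. q x) + (INF q\<in>C. q y)"
    if x: "x \<in> V" and y: "y \<in> V" for x y
  proof -
    have xy: "x + y \<in> V" using V x y by (rule complex_vector.subspace_add)
    have *: "(INF q\<in>C. q (x + y)) \<le> q x + r y" if q: "q \<in> C" and r: "r \<in> C" for q r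
    proof -
      obtain u where u: "u \<in> C" "\<forall>x. u x \<le> q x" "\<forall>x. u x \<le> r x"
        using chain[OF q r] q r by blast
      have "(INF q\<in>C. q (x + y)) \<le> u (x + y)" using lower[OF u(1) xy] .
      also have "\<dots> \<le> u x + u y" using sub[OF u(1)] x y by (simp add: sublinear_on_def)
      also have "\<dots> \<le> q x + r y" using u by (intro add_mono) auto
      finally show ?thesis .
    qed
    have "(INF q\<in>C. q (x + y)) - r y \<le> (INF q\<in>C. q x)" if "r \<in> C" for r
      using *[OF _ that] by (intro greatest) (force simp: algebra_simps)
    then have "(INF q\<in>C. q (x + y)) - (INF q\<in>C. q x) \<le> (INF q\<in>C. q y)"
      by (intro greatest) (force simp: algebra_simps)
    then show ?thesis by simp
  qed
  moreover have "(INF q\<in>C. q (complex_of_real t *\<^sub>C x)) \<le> t * (INF q\<in>C. q x)"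
    if t: "t > 0" and x: "x \<in> V" for t x
  proof -
    have "(INF q\<in>C. q (complex_of_real t *\<^sub>C x)) / t \<le> (INF q\<in>C. q x)"
    proof (rule greatest)
      fix q assume q: "q \<in> C"
      have "(INF q\<in>C. q (complex_of_real t *\<^sub>C x)) \<le> q (complex_of_real t *\<^sub>C x)"
        using lower[OF q] complex_vector.subspace_scale[OF V x] by blast
      also have "\<dots> \<le> t * q x" using sub[OF q] t x by (simp add: sublinear_on_def)
      finally show "(INF q\<in>C. q (complex_of_real t *\<^sub>C x)) / t \<le> q x"
        using t by (simp add: field_simps)
    qed
    then show ?thesis using t by (simp add: field_simps)
  qed
  ultimately show "sublinear_on V (\<lambda>x. INF q\<in>C. q x)" by (auto simp: sublinear_on_def)
qed

lemma cone_below_ray: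
  assumes V: "csubspace V" and q: "sublinear_on V q" and y: "y \<in> V"
  shows "cone_below V q {(complex_of_real t *\<^sub>C y, t * q y) | t. t \<ge> 0}"
proof -
  define G where "G = {(complex_of_real t *\<^sub>C y, t * q y) | t. t \<ge> 0}"
  have G: "s \<in> V \<and> c \<le> q s" if "(s, c) \<in> G" for s c
  proof -
    obtain t where t: "t \<ge> 0" "s = complex_of_real t *\<^sub>C y" "c = t * q y"
      using \<open>(s, c) \<in> G\<close> by (auto simp: G_def)
    have sV: "s \<in> V" using t(2) complex_vector.subspace_scale[OF V y] by simp
    have "t * q y \<le> q s"
    proof (cases "t = 0")
      case True then show ?thesis using q t by (simp add: sublinear_on_def)
    next
      case False
      \<comment> \<open>Homogeneity is assumed only as an inequality; its instance for 1/t is the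
        reverse inequality for t.\<close>
      then have "q (complex_of_real (1 / t) *\<^sub>C s) \<le> (1 / t) * q s"
        using q sV t(1) unfolding sublinear_on_def by (metis less_eq_real_def zero_less_divide_1_iff)
      then show ?thesis using False t by (simp add: scaleC_scaleC scaleC_one field_simps)
    qed
    then show ?thesis using sV t by simp
  qed
  have G0: "(0, 0) \<in> G" by (auto simp: G_def intro!: exI[of _ 0])
  have Gadd: "(s + s', c + c') \<in> G" if z: "(s, c) \<in> G" "(s', c') \<in> G" for s c s' c'
  proof -
    obtain t where "t \<ge> 0" "s = complex_of_real t *\<^sub>C y" "c = t * q y"
      using z(1) by (auto simp: G_def)
    moreover obtain t' where "t' \<ge> 0" "s' = complex_of_real t' *\<^sub>C y" "c' = t' * q y"
      using z(2) by (auto simp: G_def)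
    ultimately show ?thesis
      unfolding G_def by (auto simp: scaleC_add_left algebra_simps intro!: exI[of _ "t + t'"])
  qed
  have Gscale: "(complex_of_real t *\<^sub>C s, t * c) \<in> G" if z: "(s, c) \<in> G" "t > 0" for s c t
  proof -
    obtain t' where "t' \<ge> 0" "s = complex_of_real t' *\<^sub>C y" "c = t' * q y"
      using z(1) by (auto simp: G_def)
    then show ?thesis using z(2)
      unfolding G_def by (auto simp: scaleC_scaleC intro!: exI[of _ "t * t'"])
  qed
  have "cone_below V q G"
    unfolding cone_below_def using G G0 Gadd Gscale by blast
  then show ?thesis by (simp add: G_def)
qed

text \<open>Lowering \<open>q\<close> along the ray through \<open>y\<close> forces the value at
  \<open>- y\<close> down to at most \<open>- q y\<close>; a minimal \<open>q\<close> is unchanged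
  by this.\<close>

lemma minimal_sublinear_on_odd:
  assumes V: "csubspace V" and q: "sublinear_on V q"
    and min: "\<And>r. sublinear_on V r \<Longrightarrow> (\<And>x. x \<in> V \<Longrightarrow> r x \<le> q x) \<Longrightarrow> (\<And>x. x \<in> V \<Longrightarrow> r x = q x)"
    and y: "y \<in> V"
  shows "q (- y) = - q y"
proof -
  define G where "G = {(complex_of_real t *\<^sub>C y, t * q y) | t. t \<ge> 0}"
  have cone: "cone_below V q G" unfolding G_def using V q y by (rule cone_below_ray)
  have G1: "(y, q y) \<in> G" by (auto simp: G_def scaleC_one intro!: exI[of _ 1])
  define r where "r = (\<lambda>x. INF z\<in>G. q (x + fst z) - snd z)"
  note r = sublinear_on_cone_infimum[OF V q cone]
  have r1: "sublinear_on V r" and r2: "\<And>x. x \<in> V \<Longrightarrow> r x \<le> q x" and r3: "r (- y) \<le> - q y"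
    unfolding r_def using r(1) r(2) r(3)[OF G1] by simp_all
  have "q (- y) = r (- y)"
    using min[OF r1 r2] complex_vector.subspace_neg[OF V y] by simp
  also have "\<dots> \<le> - q y" by (rule r3)
  finally show ?thesis using sublinear_on_lower[OF V q y] by simp
qed

lemma sublinear_on_odd_imp_real_linear_on:
  assumes V: "csubspace V" and q: "sublinear_on V q"
    and odd: "\<And>y. y \<in> V \<Longrightarrow> q (- y) = - q y"
  shows "real_linear_on V q"
proof -
  note V_add = complex_vector.subspace_add[OF V]
  note V_neg = complex_vector.subspace_neg[OF V]
  note V_scale = complex_vector.subspace_scale[OF V]
  have q0: "q 0 = 0" and qadd: "\<And>x y. x \<in> V \<Longrightarrow> y \<in> V \<Longrightarrow> q (x + y) \<le> q x + q y"
    and qscale: "\<And>t x. t > 0 \<Longrightarrow> x \<in> V \<Longrightarrow> q (complex_of_real t *\<^sub>C x) \<le> t * q x"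
    using q by (auto simp: sublinear_on_def)
  have add: "q (x + y) = q x + q y" if "x \<in> V" "y \<in> V" for x y
    using qadd[OF that] qadd[of "- x" "- y"] odd[of "x + y"] odd[of x] odd[of y] that V_add V_neg
    by simp
  have pos: "q (complex_of_real t *\<^sub>C x) = t * q x" if "t > 0" "x \<in> V" for t x
  proof -
    have "q (complex_of_real t *\<^sub>C (- x)) \<le> t * q (- x)" using qscale that V_neg by blast
    then show ?thesis
      using qscale[OF that] odd[OF that(2)] odd[OF V_scale[OF that(2)]] by simp
  qed
  have "q (complex_of_real t *\<^sub>C x) = t * q x" if x: "x \<in> V" for t x
  proof -
    consider "t = 0" | "t > 0" | "t < 0" by linarith
    then show ?thesis
    proof cases
      case 3
      have "q (complex_of_real (- t) *\<^sub>C x) = - t * q x" using pos[OF _ x, of "- t"] 3 by simp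
      then show ?thesis using odd[OF V_scale[OF x], of "complex_of_real t"] by simp
    qed (use q0 pos x in auto)
  qed
  with add show ?thesis by (auto simp: real_linear_on_def)
qed

text \<open>A minimal sublinear function below \<open>p\<close> is automatically linear, so Zorn's
  lemma is applied to sublinear functions instead of partially defined functionals.\<close>

theorem Hahn_Banach_sublinear:
  assumes V: "csubspace V" and p: "sublinear_on V p"
  obtains F where "real_linear_on V F" "\<And>x. x \<in> V \<Longrightarrow> F x \<le> p x"
proof -
  \<comment> \<open>Values outside \<open>V\<close> are fixed as 0 because antisymmetry requires
    equality on the whole type. The order \<open>R\<close> is reversed, so that a maximal element is
    a minimal function.\<close>
  define A where "A = {q. sublinear_on V q \<and> (\<forall>x\<in>V. q x \<le> p x) \<and> (\<forall>x. x \<notin> V \<longrightarrow> q x = 0)}"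
  define R where "R = (\<lambda>q r :: 'a \<Rightarrow> real. \<forall>x. r x \<le> q x)"
  have cutA: "(\<lambda>x. if x \<in> V then q x else 0) \<in> A"
    if "sublinear_on V q" "\<And>x. x \<in> V \<Longrightarrow> q x \<le> p x" for q
    using that sublinear_on_cong[OF V that(1), of "\<lambda>x. if x \<in> V then q x else 0"] by (auto simp: A_def)
  have "partial_order_on A (relation_of R A)"
  proof (rule partial_order_on_relation_ofI)
    show "R a c" if "R a b" "R b c" for a b c
      using that unfolding R_def by (meson order_trans)
    show "a = b" if "R a b" "R b a" for a b
      using that unfolding R_def by (intro ext antisym) auto
  qed (simp add: R_def)
  moreover have "\<exists>u\<in>A. \<forall>a\<in>C. R a u" if C: "C \<in> Chains (relation_of R A)" for C
  proof (cases "C = {}")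
    case True then show ?thesis using cutA[OF p] by auto
  next
    case False
    have CA: "C \<subseteq> A" and chain: "\<forall>q\<in>C. \<forall>r\<in>C. (\<forall>x. q x \<le> r x) \<or> (\<forall>x. r x \<le> q x)"
      using C by (auto simp: Chains_def relation_of_def R_def)
    have "\<forall>q\<in>C. sublinear_on V q \<and> (\<forall>x\<in>V. q x \<le> p x)"
      using CA by (auto simp: A_def)
    note inf = sublinear_on_chain_infimum[OF V False this chain]
    obtain q0 where q0: "q0 \<in> C" using False by blast
    let ?u = "\<lambda>x. if x \<in> V then INF q\<in>C. q x else 0"
    have "(INF q\<in>C. q x) \<le> p x" if "x \<in> V" for x
      using inf(2)[OF q0 that] q0 CA that by (force simp: A_def)
    then have "?u \<in> A" using cutA[OF inf(1)] by blast
    moreover have "R a ?u" if "a \<in> C" for a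
      using that inf(2)[OF that] CA by (auto simp: R_def A_def)
    ultimately show ?thesis by blast
  qed
  ultimately obtain m where m: "m \<in> A" "\<And>a. a \<in> A \<Longrightarrow> R m a \<Longrightarrow> a = m"
    using predicate_Zorn[of A R] by blast
  have msub: "sublinear_on V m" and mp: "\<And>x. x \<in> V \<Longrightarrow> m x \<le> p x" and m0: "\<And>x. x \<notin> V \<Longrightarrow> m x = 0"
    using m(1) by (auto simp: A_def)
  have "r x = m x" if r: "sublinear_on V r" "\<And>x. x \<in> V \<Longrightarrow> r x \<le> m x" and x: "x \<in> V" for r x
  proof -
    have "(\<lambda>x. if x \<in> V then r x else 0) \<in> A"
      using r mp by (intro cutA) (auto intro: order_trans)
    moreover have "R m (\<lambda>x. if x \<in> V then r x else 0)" using r m0 by (auto simp: R_def)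
    ultimately have "(\<lambda>x. if x \<in> V then r x else 0) = m" by (rule m(2))
    from fun_cong[OF this, of x] show ?thesis using x by simp
  qed
  then have "\<And>y. y \<in> V \<Longrightarrow> m (- y) = - m y" by (rule minimal_sublinear_on_odd[OF V msub])
  then have "real_linear_on V m" by (rule sublinear_on_odd_imp_real_linear_on[OF V msub])
  then show thesis using mp that by blast
qed

corollary Hahn_Banach_cone:
  assumes V: "csubspace V" and p: "sublinear_on V p" and G: "cone_below V p G"
  obtains F where "real_linear_on V F" "\<And>x. x \<in> V \<Longrightarrow> F x \<le> p x"
    "\<And>s c. (s, c) \<in> G \<Longrightarrow> c \<le> F s"
proof -
  define r where "r = (\<lambda>x. INF z\<in>G. p (x + fst z) - snd z)"
  note inf = sublinear_on_cone_infimum[OF V p G]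
  have "sublinear_on V r" unfolding r_def by (rule inf(1))
  then obtain F where F: "real_linear_on V F" "\<And>x. x \<in> V \<Longrightarrow> F x \<le> r x"
    using Hahn_Banach_sublinear[OF V] by metis
  have "c \<le> F s" if z: "(s, c) \<in> G" for s c
  proof -
    have s: "s \<in> V" using G z by (auto simp: cone_below_def)
    have "F (complex_of_real (- 1) *\<^sub>C s) = - 1 * F s"
      using F(1) s unfolding real_linear_on_def by blast
    then have "F (- s) = - F s" by simp
    moreover have "r (- s) \<le> - c" unfolding r_def using z by (rule inf(3))
    ultimately show ?thesis using F(2)[OF complex_vector.subspace_neg[OF V s]] by simp
  qed
  moreover have "F x \<le> p x" if "x \<in> V" for x
    using F(2)[OF that] inf(2)[OF that] unfolding r_def by simp
  ultimately show thesis using F(1) that by blast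
qed

subsection \<open>Seminorms and dual spaces on a carrier\<close>

text \<open>Definiteness is left out on purpose: the seminorm \<open>K * cmod (\<phi> x)\<close>,
  which vanishes on the kernel of \<open>\<phi>\<close>, is used below to control a single
  value.\<close>

definition seminorm_on :: "'v::complex_vector set \<Rightarrow> ('v \<Rightarrow> real) \<Rightarrow> bool" where
  "seminorm_on V N \<longleftrightarrow> (\<forall>x\<in>V. \<forall>y\<in>V. N (x + y) \<le> N x + N y) \<and>
     (\<forall>a. \<forall>x\<in>V. N (a *\<^sub>C x) = cmod a * N x)"

lemma seminorm_on_triangle: "seminorm_on V N \<Longrightarrow> x \<in> V \<Longrightarrow> y \<in> V \<Longrightarrow> N (x + y) \<le> N x + N y"
  by (auto simp: seminorm_on_def)

lemma seminorm_on_scale: "seminorm_on V N \<Longrightarrow> x \<in> V \<Longrightarrow> N (a *\<^sub>C x) = cmod a * N x"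
  by (auto simp: seminorm_on_def)

lemma seminorm_on_zero: "csubspace V \<Longrightarrow> seminorm_on V N \<Longrightarrow> N 0 = 0"
  using seminorm_on_scale[of V N 0 0] complex_vector.subspace_0[of V] by simp

lemma seminorm_on_minus: "seminorm_on V N \<Longrightarrow> x \<in> V \<Longrightarrow> N (- x) = N x"
  using seminorm_on_scale[of V N x "- 1"] by simp

lemma seminorm_on_nonneg:
  assumes "csubspace V" "seminorm_on V N" "x \<in> V"
  shows "0 \<le> N x"
  using seminorm_on_triangle[OF assms(2,3), of "- x"] seminorm_on_minus[OF assms(2,3)]
    seminorm_on_zero[OF assms(1,2)] complex_vector.subspace_neg[OF assms(1,3)] by simp

lemma seminorm_on_norm: "seminorm_on UNIV (norm :: 'a::complex_normed_vector \<Rightarrow> real)"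
  by (auto simp: seminorm_on_def norm_scaleC norm_triangle_ineq)

lemma csubspace_UNIV: "csubspace (UNIV :: 'v::complex_vector set)"
  by simp

lemma real_linear_on_sum:
  assumes V: "csubspace V" and F: "real_linear_on V F" and "finite J" and "\<And>i. i \<in> J \<Longrightarrow> u i \<in> V"
  shows "F (sum u J) = (\<Sum>i\<in>J. F (u i))"
  using assms(3,4)
proof (induction J rule: finite_induct)
  case empty
  have "F (complex_of_real 0 *\<^sub>C 0) = 0 * F 0"
    using F complex_vector.subspace_0[OF V] unfolding real_linear_on_def by blast
  then show ?case by simp
next
  case (insert j J)
  have "sum u J \<in> V" using insert.prems by (intro complex_vector.subspace_sum[OF V]) auto
  then show ?case using insert F by (simp add: real_linear_on_def)
qed

lemma dual_clinear:
  assumes "f \<in> dual V N"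
  shows "x \<in> V \<Longrightarrow> y \<in> V \<Longrightarrow> f (x + y) = f x + f y" "x \<in> V \<Longrightarrow> f (a *\<^sub>C x) = a * f x"
    "x \<notin> V \<Longrightarrow> f x = 0"
  using assms by (auto simp: dual_def clinear_on_def scaleC_complex_def)

lemma dual_diff:
  assumes "csubspace V" "f \<in> dual V N" "x \<in> V" "y \<in> V"
  shows "f (x - y) = f x - f y"
  using dual_clinear(1)[OF assms(2), of "x - y" y] complex_vector.subspace_diff[OF assms(1,3,4)] assms
  by simp

lemma dual_minus:
  assumes "csubspace V" "f \<in> dual V N" "x \<in> V"
  shows "f (- x) = - f x"
  using dual_clinear(2)[OF assms(2,3), of "- 1"] by simp

lemma sum_in_dual: "(\<And>i. i \<in> I \<Longrightarrow> g i \<in> dual V N) \<Longrightarrow> sum g I \<in> dual V N"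
  using complex_vector.subspace_sum[OF csubspace_dual, of I g V N] by blast

lemma norm_dual_le:
  assumes V: "csubspace V" and N: "seminorm_on V N" and f: "f \<in> dual V N" and x: "x \<in> V"
  shows "cmod (f x) \<le> dual_norm V N f * N x"
proof (cases "N x = 0")
  case True
  obtain B where "cmod (f x) \<le> B * N x" using f x by (auto simp: dual_def)
  then show ?thesis using True by simp
next
  case False
  then have pos: "N x > 0" using seminorm_on_nonneg[OF V N x] by simp
  let ?y = "complex_of_real (1 / N x) *\<^sub>C x"
  have y: "?y \<in> V" using V x by (rule complex_vector.subspace_scale)
  have "N ?y \<le> 1" using pos by (simp add: seminorm_on_scale[OF N x] norm_divide)
  then have "cmod (f ?y) \<le> dual_norm V N f"
    using dual_norm_bound[OF f y] seminorm_on_nonneg[OF V N] by blast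
  also have "f ?y = complex_of_real (1 / N x) * f x" using dual_clinear(2)[OF f x] .
  finally show ?thesis using pos by (simp add: norm_mult norm_divide field_simps)
qed

lemma dual_norm_le:
  assumes V: "csubspace V" and N: "seminorm_on V N"
    and "0 \<le> B" "\<And>x. x \<in> V \<Longrightarrow> cmod (f x) \<le> B * N x"
  shows "dual_norm V N f \<le> B"
  unfolding dual_norm_def
proof (rule cSUP_least)
  show "{x \<in> V. N x \<le> 1} \<noteq> {}"
    using seminorm_on_zero[OF V N] complex_vector.subspace_0[OF V] by auto
  fix x assume "x \<in> {x \<in> V. N x \<le> 1}"
  then show "cmod (f x) \<le> B"
    using assms(4)[of x] mult_left_mono[of "N x" 1 B] assms(3) by auto
qed

lemma dual_norm_nonneg:
  assumes V: "csubspace V" and N: "seminorm_on V N" and f: "f \<in> dual V N"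
  shows "0 \<le> dual_norm V N f"
  using dual_norm_bound[OF f complex_vector.subspace_0[OF V]] seminorm_on_nonneg[OF V N]
    seminorm_on_zero[OF V N] norm_ge_zero order_trans by (metis zero_le_one)

lemma seminorm_on_dual_norm:
  assumes V: "csubspace V" and N: "seminorm_on V N"
  shows "seminorm_on (dual V N) (dual_norm V N)"
proof -
  have le: "dual_norm V N (a *\<^sub>C f) \<le> cmod a * dual_norm V N f" if f: "f \<in> dual V N" for a f
  proof (rule dual_norm_le[OF V N])
    show "0 \<le> cmod a * dual_norm V N f" using dual_norm_nonneg[OF V N f] by simp
    fix x assume "x \<in> V"
    then show "cmod ((a *\<^sub>C f) x) \<le> cmod a * dual_norm V N f * N x"
      using norm_dual_le[OF V N f] 
      by (simp add: scaleC_fun_def scaleC_complex_def norm_mult mult.assoc mult_left_mono)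
  qed
  have "dual_norm V N (f + g) \<le> dual_norm V N f + dual_norm V N g"
    if f: "f \<in> dual V N" and g: "g \<in> dual V N" for f g
  proof (rule dual_norm_le[OF V N])
    show "0 \<le> dual_norm V N f + dual_norm V N g"
      using dual_norm_nonneg[OF V N f] dual_norm_nonneg[OF V N g] by simp
    fix x assume "x \<in> V"
    then show "cmod ((f + g) x) \<le> (dual_norm V N f + dual_norm V N g) * N x"
      using norm_dual_le[OF V N f] norm_dual_le[OF V N g]
      by (simp add: distrib_right) (meson add_mono norm_triangle_le)
  qed
  moreover have "dual_norm V N (a *\<^sub>C f) = cmod a * dual_norm V N f" if f: "f \<in> dual V N" for a f
  proof (cases "a = 0")
    case True
    then show ?thesis using le[OF f, of 0] dual_norm_nonneg[OF V N, of 0]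
        complex_vector.subspace_0[OF csubspace_dual, of V N] by simp
  next
    case False
    have "a *\<^sub>C f \<in> dual V N" using csubspace_dual f by (rule complex_vector.subspace_scale)
    from le[OF this, of "1 / a"] have "dual_norm V N f \<le> dual_norm V N (a *\<^sub>C f) / cmod a"
      using False by (simp add: scaleC_scaleC scaleC_one norm_divide)
    then show ?thesis using le[OF f, of a] False by (simp add: field_simps)
  qed
  ultimately show ?thesis by (auto simp: seminorm_on_def)
qed

lemma dual_norm_eq_0_imp:
  assumes V: "csubspace V" and N: "seminorm_on V N" and f: "f \<in> dual V N" and "dual_norm V N f = 0"
  shows "f = 0"
proof
  fix x show "f x = 0 x"
    using norm_dual_le[OF V N f, of x] assms(4) dual_clinear(3)[OF f, of x] by (cases "x \<in> V") auto
qed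

text \<open>The usual passage \<open>F x - \<i> F (\<i> x)\<close> from a real functional to the
  complex one with real part \<open>F\<close>, cut to 0 outside \<open>V\<close> as
  \<open>dual\<close> demands.\<close>

definition complexification_on ::
  "'v::complex_vector set \<Rightarrow> ('v \<Rightarrow> real) \<Rightarrow> 'v \<Rightarrow> complex" where
  "complexification_on V F x = (if x \<in> V then Complex (F x) (- F (\<i> *\<^sub>C x)) else 0)"

text \<open>The bound for the real part transfers to the modulus: rotating \<open>x\<close> by a
  phase makes the value real and leaves \<open>N x\<close> unchanged.\<close>

lemma complexification_on:
  assumes V: "csubspace V" and N: "seminorm_on V N" and F: "real_linear_on V F"
    and le: "\<And>x. x \<in> V \<Longrightarrow> F x \<le> N x"
  shows "complexification_on V F \<in> dual V N"
    and "\<And>x. x \<in> V \<Longrightarrow> cmod (complexification_on V F x) \<le> N x"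
    and "\<And>x. x \<in> V \<Longrightarrow> Re (complexification_on V F x) = F x"
proof -
  let ?f = "complexification_on V F"
  note V_scale = complex_vector.subspace_scale[OF V]
  note V_add = complex_vector.subspace_add[OF V]
  have Fadd: "F (x + y) = F x + F y" if "x \<in> V" "y \<in> V" for x y
    using F that by (auto simp: real_linear_on_def)
  have Fscale: "F (complex_of_real t *\<^sub>C x) = t * F x" if "x \<in> V" for x t
    using F that by (auto simp: real_linear_on_def)
  have add: "?f (x + y) = ?f x + ?f y" if "x \<in> V" "y \<in> V" for x y
    using that V_add V_scale
    by (simp add: complexification_on_def Fadd scaleC_add_right complex_eq_iff)
  have real_scale: "?f (complex_of_real t *\<^sub>C x) = complex_of_real t * ?f x" if "x \<in> V" for t x
  proof -
    have "F ((\<i> * complex_of_real t) *\<^sub>C x) = t * F (\<i> *\<^sub>C x)"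
      using Fscale[OF V_scale[OF that], of t \<i>] by (simp add: scaleC_scaleC mult.commute)
    then show ?thesis
      using that V_scale by (simp add: complexification_on_def Fscale complex_eq_iff)
  qed
  have i_scale: "?f (\<i> *\<^sub>C x) = \<i> * ?f x" if "x \<in> V" for x
  proof -
    have "\<i> *\<^sub>C \<i> *\<^sub>C x = complex_of_real (- 1) *\<^sub>C x" by (simp add: scaleC_scaleC)
    then show ?thesis
      using that V_scale Fscale[OF that, of "- 1"]
      by (simp add: complexification_on_def complex_eq_iff)
  qed
  have scale: "?f (a *\<^sub>C x) = a * ?f x" if "x \<in> V" for a x
  proof -
    have "a *\<^sub>C x = complex_of_real (Re a) *\<^sub>C x + complex_of_real (Im a) *\<^sub>C \<i> *\<^sub>C x"
      by (simp add: scaleC_scaleC scaleC_add_left[symmetric] complex_eq_iff)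
    then have "?f (a *\<^sub>C x) = complex_of_real (Re a) * ?f x + complex_of_real (Im a) * (\<i> * ?f x)"
      using that V_scale by (simp only: add real_scale i_scale)
    also have "\<dots> = (complex_of_real (Re a) + \<i> * complex_of_real (Im a)) * ?f x"
      by (simp add: algebra_simps)
    also have "\<dots> = a * ?f x" by (simp only: complex_eq[symmetric])
    finally show ?thesis .
  qed
  show re: "Re (?f x) = F x" if "x \<in> V" for x
    using that by (simp add: complexification_on_def)
  show bound: "cmod (?f x) \<le> N x" if x: "x \<in> V" for x
  proof (cases "?f x = 0")
    case True then show ?thesis using seminorm_on_nonneg[OF V N x] by simp
  next
    case False
    let ?a = "cnj (?f x) / cmod (?f x)"
    have "?f (?a *\<^sub>C x) = complex_of_real (cmod (?f x))"
      using False complex_norm_square[of "?f x"]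
      by (simp add: scale[OF x] field_simps power2_eq_square)
    then have "cmod (?f x) = F (?a *\<^sub>C x)"
      using re[OF V_scale[OF x], of ?a] by simp
    also have "\<dots> \<le> N (?a *\<^sub>C x)" using le V_scale[OF x] by blast
    also have "\<dots> = N x" using False by (simp add: seminorm_on_scale[OF N x] norm_divide)
    finally show ?thesis .
  qed
  show "?f \<in> dual V N"
    unfolding dual_def clinear_on_def
    using add scale bound by (auto simp: scaleC_complex_def complexification_on_def intro!: exI[of _ 1])
qed

subsection \<open>Distance duality for tuples\<close>

text \<open>The entries of \<open>u\<close> are chosen independently, so suprema may be taken in one
  coordinate after another. This turns an estimate on all tuples of the unit ball into one for the
  sum of dual norms.\<close>

lemma sum_cSUP_le:
  fixes h :: "'i \<Rightarrow> 'v \<Rightarrow> real"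
  assumes "finite I" "\<And>i. i \<in> I \<Longrightarrow> A i \<noteq> {}"
    "\<And>u. (\<And>i. i \<in> I \<Longrightarrow> u i \<in> A i) \<Longrightarrow> (\<Sum>i\<in>I. h i (u i)) \<le> s"
  shows "(\<Sum>i\<in>I. SUP x\<in>A i. h i x) \<le> s"
  using assms
proof (induction I arbitrary: s rule: finite_induct)
  case empty then show ?case by simp
next
  case (insert j I)
  have "h j x \<le> s - (\<Sum>i\<in>I. SUP x\<in>A i. h i x)" if x: "x \<in> A j" for x
  proof -
    have "(\<Sum>i\<in>I. SUP x\<in>A i. h i x) \<le> s - h j x"
    proof (rule insert.IH)
      fix u assume u: "\<And>i. i \<in> I \<Longrightarrow> u i \<in> A i"
      have "(\<Sum>i\<in>insert j I. h i ((u(j := x)) i)) \<le> s"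
        using u x by (intro insert.prems(2)) auto
      moreover have "(\<Sum>i\<in>I. h i ((u(j := x)) i)) = (\<Sum>i\<in>I. h i (u i))"
        using insert.hyps by (intro sum.cong) auto
      ultimately show "(\<Sum>i\<in>I. h i (u i)) \<le> s - h j x" using insert.hyps by simp
    qed (use insert.prems in auto)
    then show ?thesis by simp
  qed
  then have "(SUP x\<in>A j. h j x) \<le> s - (\<Sum>i\<in>I. SUP x\<in>A i. h i x)"
    using insert.prems(1)[of j] by (intro cSUP_least) auto
  then show ?case using insert.hyps by simp
qed

lemma cmod_rotate:
  obtains a where "cmod a = 1" "a * z = complex_of_real (cmod z)"
proof (cases "z = 0")
  case True then show ?thesis using that[of 1] by simp
next
  case False
  then have "cnj z / cmod z * z = complex_of_real (cmod z)"
    using complex_norm_square[of z] by (simp add: field_simps power2_eq_square)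
  then show ?thesis using that[of "cnj z / cmod z"] False by (simp add: norm_divide)
qed

text \<open>
  The distance from \<open>(a\<^sub>i)\<close> to the diagonal copy of \<open>M\<close> in the \<open>\<ell>\<^sup>\<infinity>\<close>-sum of the spaces
  \<open>(V, N\<^sub>i)\<close> is attained by a functional, that is, by a tuple \<open>(g\<^sub>i)\<close> in the unit ball of the
  \<open>\<ell>\<^sup>1\<close>-sum of the duals whose sum annihilates \<open>M\<close>.
\<close>

lemma tuple_distance_duality:
  fixes N :: "'i \<Rightarrow> 'v::complex_vector \<Rightarrow> real" and a :: "'i \<Rightarrow> 'v"
  assumes V: "csubspace V" and I: "finite I" "I \<noteq> {}"
    and N: "\<And>i. i \<in> I \<Longrightarrow> seminorm_on V (N i)"
    and M: "csubspace M" "M \<subseteq> V" and a: "\<And>i. i \<in> I \<Longrightarrow> a i \<in> V"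
  obtains g where "\<And>i. i \<in> I \<Longrightarrow> g i \<in> dual V (N i)"
    "\<And>i x. i \<in> I \<Longrightarrow> x \<in> V \<Longrightarrow> cmod (g i x) \<le> N i x"
    "\<And>y. y \<in> M \<Longrightarrow> (\<Sum>i\<in>I. g i y) = 0"
    "\<And>u s. (\<And>i. i \<in> I \<Longrightarrow> u i \<in> V \<and> N i (u i) \<le> s) \<Longrightarrow> (\<Sum>i\<in>I. cmod (g i (u i))) \<le> s"
    "\<And>\<eta>. \<eta> > 0 \<Longrightarrow> \<exists>y\<in>M. \<forall>i\<in>I. N i (a i - y) < (\<Sum>i\<in>I. Re (g i (a i))) + \<eta>"
proof -
  \<comment> \<open>Entries outside \<open>I\<close> are unconstrained and invisible to
    \<open>p\<close>; \<open>D\<close> sets them to 0, and \<open>F0\<close> below shows that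
    \<open>F\<close> ignores them.\<close>
  define W where "W = {u :: 'i \<Rightarrow> 'v. \<forall>i\<in>I. u i \<in> V}"
  define p where "p = (\<lambda>u. Max ((\<lambda>i. N i (u i)) ` I))"
  define D where "D = (\<lambda>u (j::'i). if j \<in> I then u j else (0::'v))"
  define G where "G = {(\<lambda>_::'i. y, 0::real) | y. y \<in> M}"
  have W: "csubspace W"
    unfolding W_def complex_vector.subspace_def scaleC_fun_def
    using complex_vector.subspace_0[OF V] complex_vector.subspace_add[OF V]
      complex_vector.subspace_scale[OF V] by auto
  have pge: "N i (u i) \<le> p u" if "i \<in> I" for i u
    using I that by (auto simp: p_def)
  have ple: "p u \<le> s" if "\<And>i. i \<in> I \<Longrightarrow> N i (u i) \<le> s" for u s
    using I that by (auto simp: p_def)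
  have N0: "N i 0 = 0" if "i \<in> I" for i using seminorm_on_zero[OF V N[OF that]] .
  have nonneg: "N i x \<ge> 0" if "i \<in> I" "x \<in> V" for i x
    using seminorm_on_nonneg[OF V N] that by blast
  have p0: "p u = 0" if "\<And>i. i \<in> I \<Longrightarrow> u i = 0" for u
  proof -
    have "p u \<le> 0" by (rule ple) (simp add: that N0)
    moreover obtain i where "i \<in> I" using I by blast
    then have "0 \<le> p u" using pge[of i u] that N0 by simp
    ultimately show ?thesis by simp
  qed
  have p: "sublinear_on W p"
    unfolding sublinear_on_def
  proof (intro conjI ballI allI impI)
    show "p 0 = 0" by (rule p0) simp
  next
    fix u v assume uv: "u \<in> W" "v \<in> W"
    show "p (u + v) \<le> p u + p v"
    proof (rule ple)
      fix i assume i: "i \<in> I"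
      have "N i (u i + v i) \<le> N i (u i) + N i (v i)"
        using seminorm_on_triangle[OF N] i uv by (auto simp: W_def)
      then show "N i ((u + v) i) \<le> p u + p v" using pge[OF i, of u] pge[OF i, of v] by simp
    qed
  next
    fix t :: real and u assume t: "t > 0" and u: "u \<in> W"
    show "p (complex_of_real t *\<^sub>C u) \<le> t * p u"
    proof (rule ple)
      fix i assume i: "i \<in> I"
      have "N i (complex_of_real t *\<^sub>C u i) = t * N i (u i)"
        using seminorm_on_scale[OF N] i u t by (auto simp: W_def)
      then show "N i ((complex_of_real t *\<^sub>C u) i) \<le> t * p u"
        using pge[OF i, of u] t by (simp add: scaleC_fun_def)
    qed
  qed
  have pnonneg: "0 \<le> p u" if "u \<in> W" for u
  proof -
    obtain i where "i \<in> I" using I by blast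
    then show ?thesis using pge[of i u] nonneg[of i "u i"] that by (force simp: W_def)
  qed
  have GW: "(\<lambda>_. y) \<in> W" if "y \<in> M" for y using M that by (auto simp: W_def)
  have G: "cone_below W p G"
    unfolding cone_below_def
  proof (intro conjI allI impI)
    show "(0, 0) \<in> G"
      using complex_vector.subspace_0[OF M(1)] by (auto simp: G_def intro!: exI[of _ 0])
  next
    fix s c assume "(s, c) \<in> G" then show "s \<in> W" "c \<le> p s" using GW pnonneg by (auto simp: G_def)
  next
    fix s c s' c' assume "(s, c) \<in> G" "(s', c') \<in> G"
    then obtain y y' where "y \<in> M" "s = (\<lambda>_. y)" "c = 0" "y' \<in> M" "s' = (\<lambda>_. y')" "c' = 0"
      by (auto simp: G_def)
    then show "(s + s', c + c') \<in> G"
      using complex_vector.subspace_add[OF M(1)]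
      by (auto simp: G_def intro!: exI[of _ "y + y'"])
  next
    fix t :: real and s c assume "(s, c) \<in> G"
    then obtain y where "y \<in> M" "s = (\<lambda>_. y)" "c = 0" by (auto simp: G_def)
    then show "(complex_of_real t *\<^sub>C s, t * c) \<in> G"
      using complex_vector.subspace_scale[OF M(1)] 
      by (auto simp: G_def scaleC_fun_def intro!: exI[of _ "complex_of_real t *\<^sub>C y"])
  qed
  \<comment> \<open>The distance, in the maximum of the seminorms, from \<open>u\<close> to the
    constant tuples with values in \<open>M\<close>.\<close>
  define q where "q = (\<lambda>u. INF z\<in>G. p (u + fst z) - snd z)"
  note inf = sublinear_on_cone_infimum[OF W p G]
  have q: "sublinear_on W q" unfolding q_def by (rule inf(1))
  have q_le: "q u \<le> p u" if "u \<in> W" for u unfolding q_def using that by (rule inf(2))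
  have q_diag: "q (- (\<lambda>_. y)) \<le> 0" if "y \<in> M" for y
  proof -
    have "(\<lambda>_. y, 0) \<in> G" using that by (auto simp: G_def)
    from inf(3)[OF this] show ?thesis unfolding q_def by simp
  qed
  have Da: "D a \<in> W" using a by (auto simp: W_def D_def)
  \<comment> \<open>The ray through \<open>D a\<close> makes \<open>F\<close> reach the distance at
    \<open>a\<close>, while \<open>F \<le> q\<close> makes it vanish on the diagonal copy of
    \<open>M\<close>.\<close>
  obtain F where F: "real_linear_on W F" "\<And>u. u \<in> W \<Longrightarrow> F u \<le> q u"
    and Fa': "\<And>s c. (s, c) \<in> {(complex_of_real t *\<^sub>C D a, t * q (D a)) | t. t \<ge> 0} \<Longrightarrow> c \<le> F s"
    using Hahn_Banach_cone[OF W q cone_below_ray[OF W q Da]] by blast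
  have Fa: "q (D a) \<le> F (D a)"
    by (rule Fa') (auto intro!: exI[of _ 1] simp: scaleC_one)
  have F_add: "F (u + v) = F u + F v" if "u \<in> W" "v \<in> W" for u v
    using F(1) that by (auto simp: real_linear_on_def)
  have F_scale: "F (complex_of_real t *\<^sub>C u) = t * F u" if "u \<in> W" for u t
    using F(1) that by (auto simp: real_linear_on_def)
  have Fp: "F u \<le> p u" if "u \<in> W" for u using F(2)[OF that] q_le[OF that] by simp
  have F0: "F u = 0" if "\<And>i. i \<in> I \<Longrightarrow> u i = 0" for u
  proof -
    have u: "u \<in> W" using that complex_vector.subspace_0[OF V] by (simp add: W_def)
    have "F (- u) \<le> 0" using Fp[of "- u"] p0[of "- u"] that complex_vector.subspace_neg[OF W u] by simp
    moreover have "F (- u) = - F u" using F_scale[OF u, of "- 1"] by simp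
    moreover have "F u \<le> 0" using Fp[OF u] p0[of u] that by simp
    ultimately show ?thesis by simp
  qed
  define e where "e = (\<lambda>i x (j::'i). if j = i then x else (0::'v))"
  define f where "f = (\<lambda>i x. F (e i x))"
  have eW: "e i x \<in> W" if "x \<in> V" for i x
    using that complex_vector.subspace_0[OF V] by (auto simp: e_def W_def)
  have f: "real_linear_on V (f i)" for i
  proof -
    have "e i (x + y) = e i x + e i y" "e i (complex_of_real t *\<^sub>C x) = complex_of_real t *\<^sub>C e i x"
      for x y t by (auto simp: e_def scaleC_fun_def)
    then show ?thesis using F_add F_scale eW by (auto simp: real_linear_on_def f_def)
  qed
  have f_le: "f i x \<le> N i x" if "i \<in> I" "x \<in> V" for i x
  proof -
    have "p (e i x) \<le> N i x" by (rule ple) (auto simp: e_def that N0 nonneg)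
    from order_trans[OF Fp[OF eW[OF that(2)]] this] show ?thesis by (simp add: f_def)
  qed
  have f_sum: "(\<Sum>i\<in>I. f i (u i)) = F (D u)" if u: "\<And>i. i \<in> I \<Longrightarrow> u i \<in> V" for u
  proof -
    have "D u = (\<Sum>i\<in>I. e i (u i))"
    proof
      fix j
      have "(\<Sum>i\<in>I. e i (u i)) j = (\<Sum>i\<in>I. e i (u i) j)"
        by (induction I rule: infinite_finite_induct) auto
      then show "D u j = (\<Sum>i\<in>I. e i (u i)) j"
        using I by (simp add: D_def e_def)
    qed
    then show ?thesis
      unfolding f_def using real_linear_on_sum[OF W F(1) I(1), of "\<lambda>i. e i (u i)"] eW u by simp
  qed
  define g where "g = (\<lambda>i. complexification_on V (f i))"
  have g: "g i \<in> dual V (N i)" "\<And>x. x \<in> V \<Longrightarrow> cmod (g i x) \<le> N i x"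
    "\<And>x. x \<in> V \<Longrightarrow> Re (g i x) = f i x" if "i \<in> I" for i
    using complexification_on[OF V N f f_le] that by (auto simp: g_def)
  have g_Re: "(\<Sum>i\<in>I. Re (g i (u i))) = F (D u)" if "\<And>i. i \<in> I \<Longrightarrow> u i \<in> V" for u
    using that g(3) by (subst f_sum[symmetric]) auto
  have D_le: "F (D (\<lambda>_. - y)) \<le> 0" if y: "y \<in> M" for y
  proof -
    have DW: "D (\<lambda>_. - y) \<in> W"
      using M complex_vector.subspace_neg[OF M(1) y] by (auto simp: W_def D_def)
    have *: "- (\<lambda>_. y) \<in> W" using complex_vector.subspace_neg[OF W GW[OF y]] .
    have "F (D (\<lambda>_. - y) - - (\<lambda>_. y)) = 0" by (rule F0) (simp add: D_def)
    then have "F (D (\<lambda>_. - y)) = F (- (\<lambda>_. y))"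
      using F_add[OF complex_vector.subspace_diff[OF W DW *] *] by simp
    also have "\<dots> \<le> 0" using F(2)[OF *] q_diag[OF y] by simp
    finally show ?thesis .
  qed
  have g_Re_M: "(\<Sum>i\<in>I. Re (g i y)) = 0" if y: "y \<in> M" for y
  proof -
    have ny: "- y \<in> M" using M(1) y by (rule complex_vector.subspace_neg)
    have "F (D (\<lambda>_. y)) = (\<Sum>i\<in>I. Re (g i y))" "F (D (\<lambda>_. - y)) = (\<Sum>i\<in>I. Re (g i (- y)))"
      using y ny M g_Re[of "\<lambda>_. y"] g_Re[of "\<lambda>_. - y"] by auto
    moreover have "g i (- y) = - g i y" if "i \<in> I" for i
      using dual_minus[OF V g(1)[OF that]] y M by blast
    ultimately show ?thesis
      using D_le[OF y] D_le[OF ny] by (simp add: sum_negf)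
  qed
  have g_M: "(\<Sum>i\<in>I. g i y) = 0" if y: "y \<in> M" for y
  proof -
    have iy: "\<i> *\<^sub>C y \<in> M" using M(1) y by (rule complex_vector.subspace_scale)
    have "g i (\<i> *\<^sub>C y) = \<i> * g i y" if "i \<in> I" for i
      using dual_clinear(2)[OF g(1)[OF that]] y M by blast
    then have "(\<Sum>i\<in>I. Im (g i y)) = 0" using g_Re_M[OF iy] by (simp add: sum_negf)
    then show ?thesis using g_Re_M[OF y] by (simp add: complex_eq_iff)
  qed
  have g_sum: "(\<Sum>i\<in>I. cmod (g i (u i))) \<le> s"
    if u: "\<And>i. i \<in> I \<Longrightarrow> u i \<in> V \<and> N i (u i) \<le> s" for u s
  proof -
    have "\<exists>a. cmod a = 1 \<and> a * g i (u i) = complex_of_real (cmod (g i (u i)))" for i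
      by (metis cmod_rotate)
    then obtain b where b: "\<And>i. cmod (b i) = 1"
      "\<And>i. b i * g i (u i) = complex_of_real (cmod (g i (u i)))" by metis
    let ?v = "\<lambda>i. b i *\<^sub>C u i"
    have v: "?v i \<in> V" "N i (?v i) \<le> s" "g i (?v i) = complex_of_real (cmod (g i (u i)))"
      if "i \<in> I" for i
      using u[OF that] complex_vector.subspace_scale[OF V] seminorm_on_scale[OF N[OF that]] b
        dual_clinear(2)[OF g(1)[OF that]] by auto
    have s: "0 \<le> s"
    proof -
      obtain i where "i \<in> I" using I by blast
      then show ?thesis using u[of i] nonneg[of i "u i"] by simp
    qed
    have "(\<Sum>i\<in>I. cmod (g i (u i))) = (\<Sum>i\<in>I. Re (g i (?v i)))" using v by simp
    also have "\<dots> = F (D ?v)" using v(1) by (rule g_Re)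
    also have "\<dots> \<le> p (D ?v)" using v(1) by (intro Fp) (auto simp: D_def W_def)
    also have "\<dots> \<le> s" by (rule ple) (use v s in \<open>auto simp: D_def\<close>)
    finally show ?thesis .
  qed
  have g_a: "\<exists>y\<in>M. \<forall>i\<in>I. N i (a i - y) < (\<Sum>i\<in>I. Re (g i (a i))) + \<eta>" if \<eta>: "\<eta> > 0" for \<eta>
  proof (rule ccontr)
    assume none: "\<not> ?thesis"
    have "F (D a) + \<eta> \<le> q (D a)"
      unfolding q_def
    proof (rule cINF_greatest)
      show "G \<noteq> {}" using G by (auto simp: cone_below_def)
      fix z assume "z \<in> G"
      then obtain y where y: "y \<in> M" "z = (\<lambda>_. y, 0)" by (auto simp: G_def)
      then have "- y \<in> M" using M(1) by (blast intro: complex_vector.subspace_neg)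
      then obtain i where i: "i \<in> I" "F (D a) + \<eta> \<le> N i (a i - - y)"
        using none g_Re[of a] a by (force simp: not_less)
      then show "F (D a) + \<eta> \<le> p (D a + fst z) - snd z"
        using pge[OF i(1), of "D a + fst z"] y by (simp add: D_def)
    qed
    then show False using Fa \<eta> by simp
  qed
  show thesis by (rule that[of g]) (use g g_M g_sum g_a in auto)
qed

subsection \<open>M-embedded and nonreflexive spaces\<close>

lemma seminorm_on_sublinear_on:
  assumes V: "csubspace V" and N: "seminorm_on V N"
  shows "sublinear_on V N"
  using seminorm_on_zero[OF V N] seminorm_on_triangle[OF N] seminorm_on_scale[OF N]
  by (auto simp: sublinear_on_def)

lemma norming_functional:
  fixes x :: "'a::complex_normed_vector"
  obtains f where "f \<in> dual UNIV norm" "dual_norm UNIV norm f \<le> 1" "f x = complex_of_real (norm x)"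
proof -
  have sub: "sublinear_on UNIV (norm :: 'a \<Rightarrow> real)"
    by (rule seminorm_on_sublinear_on[OF csubspace_UNIV seminorm_on_norm])
  define G where "G = {(complex_of_real t *\<^sub>C x, t * norm x) | t. t \<ge> 0}"
  have cone: "cone_below UNIV norm G"
    unfolding G_def by (rule cone_below_ray[OF csubspace_UNIV sub UNIV_I])
  obtain F where F: "real_linear_on UNIV F" "\<And>y. F y \<le> norm y"
    and FG: "\<And>s c. (s, c) \<in> G \<Longrightarrow> c \<le> F s"
    using Hahn_Banach_cone[OF csubspace_UNIV sub cone] by (metis UNIV_I)
  let ?f = "complexification_on UNIV F"
  have f: "?f \<in> dual UNIV norm" "\<And>y. cmod (?f y) \<le> norm y" "\<And>y. Re (?f y) = F y"
    using complexification_on[OF csubspace_UNIV seminorm_on_norm F] by auto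
  have "norm x \<le> F x" by (rule FG) (auto intro!: exI[of _ 1] simp: G_def scaleC_one)
  then have "Re (?f x) = norm x" using F(2)[of x] f(3)[of x] by simp
  moreover have "Im (?f x) = 0"
  proof -
    have "(cmod (?f x))\<^sup>2 \<le> (norm x)\<^sup>2" using f(2) by (intro power_mono) auto
    then have "(Im (?f x))\<^sup>2 \<le> 0" using \<open>Re (?f x) = norm x\<close> by (simp add: cmod_power2)
    then show ?thesis by simp
  qed
  ultimately have "?f x = complex_of_real (norm x)" by (simp add: complex_eq_iff)
  moreover have "dual_norm UNIV norm ?f \<le> 1"
    using f(2) by (intro dual_norm_le[OF csubspace_UNIV seminorm_on_norm]) auto
  ultimately show thesis using f(1) that by blast
qed

lemma dual_eqI_Re:
  assumes Y: "csubspace Y" "Y \<subseteq> V" "Y \<subseteq> W" and f: "f \<in> dual V N" and g: "g \<in> dual W N'"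
    and re: "\<And>y. y \<in> Y \<Longrightarrow> Re (f y) = Re (g y)" and y: "y \<in> Y"
  shows "f y = g y"
proof -
  have "Re (f (\<i> *\<^sub>C y)) = Re (g (\<i> *\<^sub>C y))"
    using re complex_vector.subspace_scale[OF Y(1) y] by blast
  then have "Im (f y) = Im (g y)"
    using dual_clinear(2)[OF f subsetD[OF Y(2) y], of \<i>]
      dual_clinear(2)[OF g subsetD[OF Y(3) y], of \<i>] by simp
  then show ?thesis using re[OF y] by (simp add: complex_eq_iff)
qed

text \<open>The demands come from the graph of \<open>Re f\<close>. It contains both signs of every
  vector, so the inequalities become equalities, and equal real parts on a complex subspace give
  equal functionals.\<close>

lemma dual_extension:
  fixes Y :: "'a::complex_normed_vector set"
  assumes Y: "csubspace Y" and f: "f \<in> dual Y norm"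
  obtains g where "g \<in> dual UNIV norm" "\<And>y. y \<in> Y \<Longrightarrow> g y = f y"
proof -
  have NY: "seminorm_on Y norm" using seminorm_on_norm by (auto simp: seminorm_on_def)
  define K where "K = dual_norm Y norm f"
  have K: "0 \<le> K" unfolding K_def by (rule dual_norm_nonneg[OF Y NY f])
  have fK: "cmod (f y) \<le> K * norm y" if "y \<in> Y" for y
    unfolding K_def by (rule norm_dual_le[OF Y NY f that])
  let ?N = "\<lambda>x::'a. K * norm x"
  have N: "seminorm_on UNIV ?N"
    using K by (auto simp: seminorm_on_def norm_scaleC distrib_left[symmetric]
        intro: mult_left_mono norm_triangle_ineq)
  define G where "G = {(y, Re (f y)) | y. y \<in> Y}"
  have cone: "cone_below UNIV ?N G"
    unfolding cone_below_def
  proof (intro conjI allI impI)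
    show "(0, 0) \<in> G"
      using complex_vector.subspace_0[OF Y] dual_clinear(2)[OF f, of 0 0]
      by (auto simp: G_def intro!: exI[of _ 0])
  next
    fix s c assume "(s, c) \<in> G" then show "s \<in> UNIV" "c \<le> ?N s"
      using order_trans[OF complex_Re_le_cmod fK] by (auto simp: G_def)
  next
    fix s c s' c' assume "(s, c) \<in> G" "(s', c') \<in> G"
    then show "(s + s', c + c') \<in> G"
      using complex_vector.subspace_add[OF Y] dual_clinear(1)[OF f] by (auto simp: G_def)
  next
    fix t :: real and s c assume "(s, c) \<in> G"
    then show "(complex_of_real t *\<^sub>C s, t * c) \<in> G"
      using complex_vector.subspace_scale[OF Y] dual_clinear(2)[OF f] by (auto simp: G_def)
  qed
  obtain F where F: "real_linear_on UNIV F" "\<And>x. F x \<le> ?N x"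
    and FG: "\<And>s c. (s, c) \<in> G \<Longrightarrow> c \<le> F s"
    using Hahn_Banach_cone[OF csubspace_UNIV seminorm_on_sublinear_on[OF csubspace_UNIV N] cone]
    by (metis UNIV_I)
  let ?g = "complexification_on UNIV F"
  have g': "?g \<in> dual UNIV ?N" "\<And>x. cmod (?g x) \<le> ?N x" "\<And>x. Re (?g x) = F x"
    using complexification_on[OF csubspace_UNIV N F] by auto
  then have g: "?g \<in> dual UNIV norm" by (auto simp: dual_def)
  have ge: "Re (f y) \<le> Re (?g y)" if "y \<in> Y" for y
    using FG[of y "Re (f y)"] that g'(3) by (auto simp: G_def)
  have "Re (?g y) = Re (f y)" if y: "y \<in> Y" for y
    using ge[OF y] ge[OF complex_vector.subspace_neg[OF Y y]] dual_minus[OF Y f y]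
      dual_minus[OF csubspace_UNIV g, of y] by simp
  then have "?g y = f y" if "y \<in> Y" for y
    using dual_eqI_Re[OF Y subset_UNIV subset_refl g f] that by blast
  then show thesis using g that by blast
qed

section \<open>The canonical embeddings into the bidual and the third dual\<close>

abbreviation Dual :: "('a::complex_normed_vector \<Rightarrow> complex) set" where
  "Dual \<equiv> dual UNIV norm"

abbreviation Dual_norm :: "('a::complex_normed_vector \<Rightarrow> complex) \<Rightarrow> real" where
  "Dual_norm \<equiv> dual_norm UNIV norm"

abbreviation Bidual :: "(('a::complex_normed_vector \<Rightarrow> complex) \<Rightarrow> complex) set" where
  "Bidual \<equiv> dual Dual Dual_norm"

abbreviation Bidual_norm :: "(('a::complex_normed_vector \<Rightarrow> complex) \<Rightarrow> complex) \<Rightarrow> real" where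
  "Bidual_norm \<equiv> dual_norm Dual Dual_norm"

abbreviation embed :: "'a::complex_normed_vector \<Rightarrow> (('a \<Rightarrow> complex) \<Rightarrow> complex)" where
  "embed \<equiv> canonical_embedding UNIV norm"

lemma seminorm_on_Dual_norm: "seminorm_on Dual Dual_norm"
  by (rule seminorm_on_dual_norm[OF csubspace_UNIV seminorm_on_norm])

lemma seminorm_on_Bidual_norm: "seminorm_on Bidual Bidual_norm"
  by (rule seminorm_on_dual_norm[OF csubspace_dual seminorm_on_Dual_norm])

lemma embed_apply: "f \<in> Dual \<Longrightarrow> embed x f = f x"
  by (simp add: canonical_embedding_def)

lemma embed_in_Bidual: "embed x \<in> Bidual"
  using canonical_embedding_in_bidual[of UNIV x norm] by (simp add: bidual_def norm_scaleC)

lemma embed_linear: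
  "embed (x + y) = embed x + embed y" "embed (a *\<^sub>C x) = a *\<^sub>C embed x"
  "embed (x - y) = embed x - embed y"
  by (intro ext, simp add: canonical_embedding_def scaleC_fun_def scaleC_complex_def
      dual_clinear[where V = UNIV and N = norm] dual_diff[where N = norm, OF csubspace_UNIV])+

lemma csubspace_embed_image:
  assumes Y: "csubspace Y"
  shows "csubspace (embed ` Y)"
proof (rule complex_vector.subspaceI)
  have "embed 0 = 0" using embed_linear(3)[of 0 0] by simp
  then show "0 \<in> embed ` Y" using complex_vector.subspace_0[OF Y] by (metis imageI)
next
  fix \<xi> \<zeta> assume "\<xi> \<in> embed ` Y" "\<zeta> \<in> embed ` Y"
  then show "\<xi> + \<zeta> \<in> embed ` Y"
    using complex_vector.subspace_add[OF Y] by (auto simp: embed_linear(1)[symmetric])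
next
  fix a \<xi> assume "\<xi> \<in> embed ` Y"
  then show "a *\<^sub>C \<xi> \<in> embed ` Y"
    using complex_vector.subspace_scale[OF Y] by (auto simp: embed_linear(2)[symmetric])
qed

lemma Bidual_norm_embed: "Bidual_norm (embed x) = norm x"
proof (rule antisym)
  show "Bidual_norm (embed x) \<le> norm x"
    using norm_dual_le[OF csubspace_UNIV seminorm_on_norm]
    by (intro dual_norm_le[OF csubspace_dual seminorm_on_Dual_norm])
      (auto simp: embed_apply mult.commute)
  obtain f where f: "f \<in> Dual" "Dual_norm f \<le> 1" "f x = complex_of_real (norm x)"
    by (rule norming_functional)
  have "norm x = cmod (embed x f)" using f by (simp add: embed_apply)
  also have "\<dots> \<le> Bidual_norm (embed x)"
    using f dual_norm_bound[OF embed_in_Bidual]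
      seminorm_on_nonneg[OF csubspace_dual seminorm_on_Dual_norm] by blast
  finally show "norm x \<le> Bidual_norm (embed x)" .
qed

text \<open>This is the canonical image of \<open>g\<close> in the third dual. Its norm bound is
  what forces the L-projection onto the annihilator of the space to send it to 0.\<close>

lemma eval_in_tridual:
  assumes g: "g \<in> Dual"
  shows "(\<lambda>\<xi>. if \<xi> \<in> Bidual then \<xi> g else 0) \<in> dual Bidual Bidual_norm" (is "?h \<in> _")
    and "dual_norm Bidual Bidual_norm (\<lambda>\<xi>. if \<xi> \<in> Bidual then \<xi> g else 0) \<le> Dual_norm g"
proof -
  have le: "cmod (?h \<xi>) \<le> Dual_norm g * Bidual_norm \<xi>" if "\<xi> \<in> Bidual" for \<xi>
    using norm_dual_le[OF csubspace_dual seminorm_on_Dual_norm that g] that by (simp add: mult.commute)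
  then show "dual_norm Bidual Bidual_norm ?h \<le> Dual_norm g"
    using dual_norm_nonneg[OF csubspace_UNIV seminorm_on_norm g]
    by (intro dual_norm_le[OF csubspace_dual seminorm_on_Bidual_norm])
  have "\<xi> + \<zeta> \<in> Bidual" "a *\<^sub>C \<xi> \<in> Bidual"
    if "\<xi> \<in> Bidual" "\<zeta> \<in> Bidual" for \<xi> \<zeta> :: "('a \<Rightarrow> complex) \<Rightarrow> complex" and a
    using that complex_vector.subspace_add[OF csubspace_dual]
      complex_vector.subspace_scale[OF csubspace_dual] by blast+
  then have "clinear_on Bidual ?h"
    by (auto simp: clinear_on_def scaleC_fun_def)
  then show "?h \<in> dual Bidual Bidual_norm"
    unfolding dual_def[of Bidual] using le by auto
qed

text \<open>
  The complementary summand of the L-projection consists exactly of the evaluations at elements of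
  the dual, because an evaluation is a norm-preserving extension of its restriction to the space and
  the L-decomposition makes such extensions unique.
\<close>

lemma M_embedded_decomposition:
  fixes \<Phi> :: "(('a::complex_normed_vector \<Rightarrow> complex) \<Rightarrow> complex) \<Rightarrow> complex"
  assumes emb: "M_embedded (UNIV :: 'a set) norm" and \<Phi>: "\<Phi> \<in> dual Bidual Bidual_norm"
  obtains g v where "g \<in> Dual" "v \<in> dual Bidual Bidual_norm"
    "\<And>x. g x = \<Phi> (embed x)" "\<And>x. v (embed x) = 0"
    "\<And>\<xi>. \<xi> \<in> Bidual \<Longrightarrow> \<Phi> \<xi> = \<xi> g + v \<xi>"
    "Dual_norm g + dual_norm Bidual Bidual_norm v \<le> dual_norm Bidual Bidual_norm \<Phi>"
proof -
  let ?T = "dual Bidual Bidual_norm :: ((('a \<Rightarrow> complex) \<Rightarrow> complex) \<Rightarrow> complex) set"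
  let ?n = "dual_norm Bidual Bidual_norm :: ((('a \<Rightarrow> complex) \<Rightarrow> complex) \<Rightarrow> complex) \<Rightarrow> real"
  let ?A = "annihilator Bidual Bidual_norm (range embed)
      :: ((('a \<Rightarrow> complex) \<Rightarrow> complex) \<Rightarrow> complex) set"
  note T = csubspace_dual[of Bidual "Bidual_norm :: (('a \<Rightarrow> complex) \<Rightarrow> complex) \<Rightarrow> real"]
  note T_diff = complex_vector.subspace_diff[OF T]
  note n_nonneg = dual_norm_nonneg[OF csubspace_dual seminorm_on_Bidual_norm]
  obtain P where P: "L_projection ?T ?n P" "P ` ?T = ?A"
    using emb by (auto simp: M_embedded_def M_ideal_def bidual_def bidual_norm_def)
  have PT: "P z \<in> ?T" and PP: "P (P z) = P z" and Pn: "?n z = ?n (P z) + ?n (z - P z)"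
    if "z \<in> ?T" for z
    using P(1) that by (auto simp: L_projection_def)
  have P_diff: "P (z - w) = P z - P w" if z: "z \<in> ?T" and w: "w \<in> ?T" for z w
  proof -
    have add: "P (x + y) = P x + P y" if "x \<in> ?T" "y \<in> ?T" for x y
      using P(1) that by (simp add: L_projection_def clinear_on_def)
    from add[OF T_diff[OF z w] w] show ?thesis by simp
  qed
  have P_fix: "P z = z" if z: "z \<in> ?A" for z
  proof -
    obtain z' where "z' \<in> ?T" "z = P z'" using z P(2) by blast
    then show ?thesis using PP by simp
  qed
  have A_iff: "z \<in> ?A \<longleftrightarrow> z \<in> ?T \<and> (\<forall>x. z (embed x) = 0)" for z
    by (auto simp: annihilator_def)
  define g where "g = (\<lambda>x. \<Phi> (embed x))"
  note lin = dual_clinear[OF \<Phi>]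
  have g_le: "cmod (\<Psi> (embed x)) \<le> ?n \<Psi> * norm x" if "\<Psi> \<in> ?T" for \<Psi> x
    using norm_dual_le[OF csubspace_dual seminorm_on_Bidual_norm that embed_in_Bidual, of x]
    by (simp add: Bidual_norm_embed)
  have g: "g \<in> Dual"
    unfolding dual_def clinear_on_def g_def
    using g_le[OF \<Phi>] by (auto simp: embed_linear lin embed_in_Bidual scaleC_complex_def)
  define v where "v = P \<Phi>"
  define h where "h = (\<lambda>\<xi>::('a \<Rightarrow> complex) \<Rightarrow> complex. if \<xi> \<in> Bidual then \<xi> g else 0)"
  have h: "h \<in> ?T" "?n h \<le> Dual_norm g"
    using eval_in_tridual[OF g] by (simp_all add: h_def)
  have h_embed: "h (embed x) = g x" for x
    by (simp add: h_def embed_in_Bidual embed_apply[OF g])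
  have Dual_norm_le: "Dual_norm g \<le> ?n \<Psi>" if "\<Psi> \<in> ?T" "\<And>x. \<Psi> (embed x) = g x" for \<Psi>
    using g_le[OF that(1)] n_nonneg[OF that(1)] that(2)
    by (intro dual_norm_le[OF csubspace_UNIV seminorm_on_norm]) auto
  have PA: "P z \<in> ?A" if "z \<in> ?T" for z using P(2) that by blast
  have P_embed: "P z (embed x) = 0" if "z \<in> ?T" for z x using PA[OF that] by (simp add: A_iff)
  \<comment> \<open>Subtracting \<open>P h\<close> does not change the restriction to the space, so
    the norm stays at least that of \<open>g\<close>, hence at least \<open>?n h\<close>; the
    L-identity then leaves no room for \<open>P h\<close>.\<close>
  have "Dual_norm g \<le> ?n (h - P h)"
    using h_embed P_embed[OF h(1)] T_diff[OF h(1) PT[OF h(1)]] by (intro Dual_norm_le) auto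
  then have "?n (P h) = 0"
    using Pn[OF h(1)] h(2) n_nonneg[OF PT[OF h(1)]] by simp
  then have Ph: "P h = 0"
    using dual_norm_eq_0_imp[OF csubspace_dual seminorm_on_Bidual_norm PT[OF h(1)]] by blast
  let ?k = "\<Phi> - P \<Phi>"
  have k: "?k \<in> ?T" using T_diff[OF \<Phi> PT[OF \<Phi>]] .
  have k_embed: "?k (embed x) = g x" for x using P_embed[OF \<Phi>] by (simp add: g_def)
  \<comment> \<open>Both have the restriction \<open>g\<close>, so their difference lies in the
    range of \<open>P\<close> and is fixed by it; but \<open>P\<close> sends both to 0.\<close>
  have "h - ?k \<in> ?A" using T_diff[OF h(1) k] h_embed k_embed by (simp add: A_iff)
  then have "h - ?k = P (h - ?k)" using P_fix by simp
  also have "\<dots> = P h - (P \<Phi> - P (P \<Phi>))"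
    using P_diff[OF h(1) k] P_diff[OF \<Phi> PT[OF \<Phi>]] by simp
  also have "\<dots> = 0" using Ph PP[OF \<Phi>] by simp
  finally have hk: "h = ?k" by simp
  show thesis
  proof (rule that[of g v])
    show "v \<in> ?T" using PT[OF \<Phi>] by (simp add: v_def)
    show "v (embed x) = 0" for x using P_embed[OF \<Phi>] by (simp add: v_def)
    show "\<Phi> \<xi> = \<xi> g + v \<xi>" if "\<xi> \<in> Bidual" for \<xi>
      using fun_cong[OF hk, of \<xi>] that by (simp add: h_def v_def)
    have "Dual_norm g \<le> ?n ?k" using Dual_norm_le[OF k k_embed] .
    then show "Dual_norm g + ?n v \<le> ?n \<Phi>" using Pn[OF \<Phi>] by (simp add: v_def)
  qed (use g in \<open>auto simp: g_def\<close>)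
qed

text \<open>An element \<open>\<Psi>\<close> of the bidual of \<open>Y\<close> that does not come
  from \<open>Y\<close> is moved to the bidual of the whole space by the second adjoint of the
  inclusion, \<open>\<theta> g = \<Psi> (restr g)\<close>. As every functional on \<open>Y\<close>
  is a restriction, \<open>\<theta>\<close> determines \<open>\<Psi>\<close>.\<close>

lemma nonreflexive_functional:
  fixes Y :: "'a::complex_normed_vector set"
  assumes Y: "csubspace Y" and nonref: "\<not> reflexive Y norm"
  obtains \<theta> where "\<theta> \<in> Bidual" "\<theta> \<notin> embed ` Y"
    "\<And>g. g \<in> Dual \<Longrightarrow> (\<And>y. y \<in> Y \<Longrightarrow> g y = 0) \<Longrightarrow> \<theta> g = 0"
proof -
  have NY: "seminorm_on Y norm" using seminorm_on_norm by (auto simp: seminorm_on_def)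
  have "canonical_embedding Y norm ` Y \<subseteq> bidual Y norm"
    using canonical_embedding_in_bidual[OF Y, where N = norm] by (auto simp: norm_scaleC)
  then obtain \<Psi> where \<Psi>: "\<Psi> \<in> dual (dual Y norm) (dual_norm Y norm)"
    "\<Psi> \<notin> canonical_embedding Y norm ` Y"
    using nonref by (auto simp: reflexive_def bidual_def)
  define restr where "restr = (\<lambda>(g :: 'a \<Rightarrow> complex) x. if x \<in> Y then g x else 0)"
  have restr: "restr g \<in> dual Y norm" if g: "g \<in> Dual" for g
    using g complex_vector.subspace_add[OF Y] complex_vector.subspace_scale[OF Y]
    by (auto simp: dual_def restr_def clinear_on_def)
  have restr_norm: "dual_norm Y norm (restr g) \<le> Dual_norm g" if g: "g \<in> Dual" for g
    using norm_dual_le[OF csubspace_UNIV seminorm_on_norm g]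
      dual_norm_nonneg[OF csubspace_UNIV seminorm_on_norm g]
    by (intro dual_norm_le[OF Y NY]) (auto simp: restr_def)
  define \<theta> where "\<theta> = (\<lambda>g. if g \<in> Dual then \<Psi> (restr g) else 0)"
  have Dual_closed: "f + g \<in> Dual" "a *\<^sub>C f \<in> Dual"
    if "f \<in> Dual" "g \<in> Dual" for f g :: "'a \<Rightarrow> complex" and a
    using that complex_vector.subspace_add[OF csubspace_dual]
      complex_vector.subspace_scale[OF csubspace_dual] by blast+
  have "\<theta> \<in> Bidual"
    unfolding dual_def[of Dual] clinear_on_def
  proof (intro CollectI conjI ballI allI impI exI)
    fix f g :: "'a \<Rightarrow> complex" assume fg: "f \<in> Dual" "g \<in> Dual"
    have "restr (f + g) = restr f + restr g" by (auto simp: restr_def)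
    then show "\<theta> (f + g) = \<theta> f + \<theta> g"
      using fg Dual_closed restr dual_clinear(1)[OF \<Psi>(1)] by (simp add: \<theta>_def)
  next
    fix a and f :: "'a \<Rightarrow> complex" assume f: "f \<in> Dual"
    have "restr (a *\<^sub>C f) = a *\<^sub>C restr f" by (auto simp: restr_def scaleC_fun_def)
    then show "\<theta> (a *\<^sub>C f) = a *\<^sub>C \<theta> f"
      using f Dual_closed restr dual_clinear(2)[OF \<Psi>(1)] by (simp add: \<theta>_def scaleC_complex_def)
  next
    fix f :: "'a \<Rightarrow> complex" assume f: "f \<in> Dual"
    let ?B = "dual_norm (dual Y norm) (dual_norm Y norm) \<Psi>"
    have "cmod (\<Psi> (restr f)) \<le> ?B * dual_norm Y norm (restr f)"
      by (rule norm_dual_le[OF csubspace_dual seminorm_on_dual_norm[OF Y NY] \<Psi>(1) restr[OF f]])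
    also have "\<dots> \<le> ?B * Dual_norm f"
      using restr_norm[OF f]
        dual_norm_nonneg[OF csubspace_dual seminorm_on_dual_norm[OF Y NY] \<Psi>(1)]
      by (rule mult_left_mono)
    finally show "cmod (\<theta> f) \<le> ?B * Dual_norm f" using f by (simp add: \<theta>_def)
  qed (simp add: \<theta>_def)
  moreover have "\<theta> \<notin> embed ` Y"
  proof
    assume "\<theta> \<in> embed ` Y"
    then obtain y where y: "y \<in> Y" "\<theta> = embed y" by blast
    have "\<Psi> f = canonical_embedding Y norm y f" for f
    proof (cases "f \<in> dual Y norm")
      case True
      obtain g where g: "g \<in> Dual" "\<And>y. y \<in> Y \<Longrightarrow> g y = f y"
        using dual_extension[OF Y True] by blast
      have "restr g = f"
        using g(2) dual_clinear(3)[OF True] by (auto simp: restr_def)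
      then have "\<Psi> f = \<theta> g" using g by (simp add: \<theta>_def)
      also have "\<dots> = f y" using y g by (simp add: embed_apply)
      finally show ?thesis using True by (simp add: canonical_embedding_def)
    next
      case False
      then show ?thesis using dual_clinear(3)[OF \<Psi>(1)] by (simp add: canonical_embedding_def)
    qed
    then have "\<Psi> = canonical_embedding Y norm y" by blast
    then show False using \<Psi>(2) y(1) by blast
  qed
  moreover have "\<theta> g = 0" if "g \<in> Dual" "\<And>y. y \<in> Y \<Longrightarrow> g y = 0" for g
  proof -
    have "restr g = 0" using that(2) by (auto simp: restr_def)
    moreover have "\<Psi> 0 = 0"
      using dual_clinear(2)[OF \<Psi>(1) complex_vector.subspace_0[OF csubspace_dual], of 0] by simp
    ultimately show ?thesis using that(1) by (simp add: \<theta>_def)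
  qed
  ultimately show thesis by (rule that)
qed

subsection \<open>Intersections of balls\<close>

lemma dual_sum:
  assumes V: "csubspace V" and f: "f \<in> dual V N" and "finite I" and "\<And>i. i \<in> I \<Longrightarrow> u i \<in> V"
  shows "f (sum u I) = (\<Sum>i\<in>I. f (u i))"
  using assms(3,4)
proof (induction I rule: finite_induct)
  case empty
  show ?case using dual_clinear(2)[OF f complex_vector.subspace_0[OF V], of 0] by simp
next
  case (insert j I)
  have "sum u I \<in> V" using insert.prems by (intro complex_vector.subspace_sum[OF V]) auto
  then show ?case using insert dual_clinear(1)[OF f, of "u j" "sum u I"] by simp
qed

lemma sum_fun_apply: "sum g I x = (\<Sum>i\<in>I. g i x)"
  by (induction I rule: infinite_finite_induct) auto

lemma sum_dual_norm_le:
  assumes V: "csubspace V" and N: "seminorm_on V N" and I: "finite I"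
    and le: "\<And>u. (\<And>i. i \<in> I \<Longrightarrow> u i \<in> V \<and> N (u i) \<le> 1) \<Longrightarrow> (\<Sum>i\<in>I. cmod (g i (u i))) \<le> s"
  shows "(\<Sum>i\<in>I. dual_norm V N (g i)) \<le> s"
  unfolding dual_norm_def
proof (rule sum_cSUP_le[OF I])
  show "{x \<in> V. N x \<le> 1} \<noteq> {}"
    using complex_vector.subspace_0[OF V] seminorm_on_zero[OF V N] by auto
qed (use le in auto)

lemma seminorm_on_dist_triangle:
  assumes V: "csubspace V" and N: "seminorm_on V N" and "x \<in> V" "y \<in> V" "z \<in> V"
  shows "N (x - z) \<le> N (x - y) + N (y - z)"
  using seminorm_on_triangle[OF N, of "x - y" "y - z"] complex_vector.subspace_diff[OF V] assms by simp

lemma seminorm_on_diff_commute: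
  assumes V: "csubspace V" and N: "seminorm_on V N" and "x \<in> V" "y \<in> V"
  shows "N (x - y) = N (y - x)"
  using seminorm_on_minus[OF N, of "x - y"] complex_vector.subspace_diff[OF V] assms by simp

text \<open>
  The intersection property of balls that makes a subspace an M-ideal, for the subspace \<open>Y\<close> of its
  weak* closure in the bidual.
\<close>

lemma M_embedded_ball_intersection:
  fixes Y :: "'a::complex_normed_vector set"
  assumes emb: "M_embedded (UNIV :: 'a set) norm" and Y: "csubspace Y"
    and \<theta>: "\<theta> \<in> Bidual" "\<And>g. g \<in> Dual \<Longrightarrow> (\<And>y. y \<in> Y \<Longrightarrow> g y = 0) \<Longrightarrow> \<theta> g = 0"
    and F: "finite F" "F \<noteq> {}" and r: "\<And>e. e \<in> F \<Longrightarrow> norm e \<le> r" "Bidual_norm \<theta> \<le> r" "r < r'"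
  obtains y where "y \<in> Y" "\<And>e. e \<in> F \<Longrightarrow> Bidual_norm (embed e + \<theta> - embed y) < r'"
proof -
  let ?n = "dual_norm Bidual Bidual_norm :: ((('a \<Rightarrow> complex) \<Rightarrow> complex) \<Rightarrow> complex) \<Rightarrow> real"
  have B: "csubspace (Bidual :: (('a \<Rightarrow> complex) \<Rightarrow> complex) set)" by (rule csubspace_dual)
  have a: "embed e + \<theta> \<in> Bidual" for e
    using B embed_in_Bidual \<theta>(1) by (rule complex_vector.subspace_add)
  have YB: "embed ` Y \<subseteq> Bidual" using embed_in_Bidual by blast
  obtain \<Phi> where \<Phi>: "\<And>e. e \<in> F \<Longrightarrow> \<Phi> e \<in> dual Bidual Bidual_norm"
    and \<Phi>_Y: "\<And>\<xi>. \<xi> \<in> embed ` Y \<Longrightarrow> (\<Sum>e\<in>F. \<Phi> e \<xi>) = 0"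
    and \<Phi>_sum: "\<And>u s. (\<And>e. e \<in> F \<Longrightarrow> u e \<in> Bidual \<and> Bidual_norm (u e) \<le> s)
      \<Longrightarrow> (\<Sum>e\<in>F. cmod (\<Phi> e (u e))) \<le> s"
    and \<Phi>_a: "\<And>\<eta>. \<eta> > 0 \<Longrightarrow> \<exists>\<xi>\<in>embed ` Y. \<forall>e\<in>F.
      Bidual_norm (embed e + \<theta> - \<xi>) < (\<Sum>e\<in>F. Re (\<Phi> e (embed e + \<theta>))) + \<eta>"
    by (rule tuple_distance_duality[of Bidual F "\<lambda>_. Bidual_norm" "embed ` Y" "\<lambda>e. embed e + \<theta>",
          OF B F seminorm_on_Bidual_norm csubspace_embed_image[OF Y] YB a]) blast
  have "\<exists>g v. g \<in> Dual \<and> v \<in> dual Bidual Bidual_norm \<and> (\<forall>x. g x = \<Phi> e (embed x)) \<and>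
      (\<forall>\<xi>\<in>Bidual. \<Phi> e \<xi> = \<xi> g + v \<xi>) \<and> Dual_norm g + ?n v \<le> ?n (\<Phi> e)" if "e \<in> F" for e
    using M_embedded_decomposition[OF emb \<Phi>[OF that]] by metis
  then obtain g v where gv: "\<And>e. e \<in> F \<Longrightarrow> g e \<in> Dual" "\<And>e. e \<in> F \<Longrightarrow> v e \<in> dual Bidual Bidual_norm"
    "\<And>e x. e \<in> F \<Longrightarrow> g e x = \<Phi> e (embed x)"
    "\<And>e \<xi>. e \<in> F \<Longrightarrow> \<xi> \<in> Bidual \<Longrightarrow> \<Phi> e \<xi> = \<xi> (g e) + v e \<xi>"
    "\<And>e. e \<in> F \<Longrightarrow> Dual_norm (g e) + ?n (v e) \<le> ?n (\<Phi> e)"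
    by metis
  have norm_sum: "(\<Sum>e\<in>F. ?n (\<Phi> e)) \<le> 1"
    by (rule sum_dual_norm_le[OF B seminorm_on_Bidual_norm F(1)]) (rule \<Phi>_sum)
  have "\<theta> (sum g F) = 0"
  proof (rule \<theta>(2))
    show "sum g F \<in> Dual" using gv(1) by (rule sum_in_dual)
    show "sum g F y = 0" if "y \<in> Y" for y
      using \<Phi>_Y[of "embed y"] that gv(3) by (simp add: sum_fun_apply)
  qed
  then have \<theta>_sum: "(\<Sum>e\<in>F. \<theta> (g e)) = 0"
    using dual_sum[OF csubspace_dual \<theta>(1) F(1) gv(1)] by simp
  obtain e0 where "e0 \<in> F" using F by blast
  then have r0: "0 \<le> r" using r(1) norm_ge_zero order_trans by blast
  have "(\<Sum>e\<in>F. Re (\<Phi> e (embed e + \<theta>))) = (\<Sum>e\<in>F. Re (g e e + \<theta> (g e) + v e \<theta>))"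
    using gv(3,4) dual_clinear(1)[OF \<Phi> embed_in_Bidual \<theta>(1)] \<theta>(1)
    by (intro sum.cong) (auto simp: add.assoc)
  also have "\<dots> = (\<Sum>e\<in>F. Re (g e e + v e \<theta>)) + Re (\<Sum>e\<in>F. \<theta> (g e))"
    by (simp add: sum.distrib)
  also have "\<dots> = (\<Sum>e\<in>F. Re (g e e + v e \<theta>))" using \<theta>_sum by simp
  \<comment> \<open>Each \<open>g e\<close> now meets only \<open>e\<close> and each
    \<open>v e\<close> only \<open>\<theta>\<close>, both of norm at most \<open>r\<close>.\<close>
  also have "\<dots> \<le> (\<Sum>e\<in>F. ?n (\<Phi> e) * r)"
  proof (rule sum_mono)
    fix e assume e: "e \<in> F"
    have "Re (g e e) \<le> Dual_norm (g e) * norm e"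
      using complex_Re_le_cmod norm_dual_le[OF csubspace_UNIV seminorm_on_norm gv(1)[OF e]]
        order_trans UNIV_I by blast
    also have "\<dots> \<le> Dual_norm (g e) * r"
      using r(1)[OF e] dual_norm_nonneg[OF csubspace_UNIV seminorm_on_norm gv(1)[OF e]]
      by (rule mult_left_mono)
    finally have 1: "Re (g e e) \<le> Dual_norm (g e) * r" .
    have "Re (v e \<theta>) \<le> ?n (v e) * Bidual_norm \<theta>"
      using complex_Re_le_cmod norm_dual_le[OF B seminorm_on_Bidual_norm gv(2)[OF e] \<theta>(1)]
        order_trans by blast
    also have "\<dots> \<le> ?n (v e) * r"
      using r(2) dual_norm_nonneg[OF B seminorm_on_Bidual_norm gv(2)[OF e]]
      by (rule mult_left_mono)
    finally have "Re (g e e + v e \<theta>) \<le> (Dual_norm (g e) + ?n (v e)) * r"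
      using 1 by (simp add: distrib_right)
    also have "\<dots> \<le> ?n (\<Phi> e) * r" using gv(5)[OF e] r0 by (rule mult_right_mono)
    finally show "Re (g e e + v e \<theta>) \<le> ?n (\<Phi> e) * r" .
  qed
  also have "\<dots> \<le> r"
    using mult_right_mono[OF norm_sum r0] by (simp add: sum_distrib_right)
  finally have "(\<Sum>e\<in>F. Re (\<Phi> e (embed e + \<theta>))) \<le> r" .
  moreover obtain y where "y \<in> Y" "\<forall>e\<in>F. Bidual_norm (embed e + \<theta> - embed y)
      < (\<Sum>e\<in>F. Re (\<Phi> e (embed e + \<theta>))) + (r' - r)"
    using \<Phi>_a[of "r' - r"] r(3) by auto
  ultimately show thesis using that[of y] by force
qed

text \<open>Helly's theorem: the seminorm \<open>K \<bar>\<phi>\<bar>\<close> serves to prescribe the value of \<open>\<phi>\<close>.\<close>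

lemma Helly_ball_intersection:
  fixes Y :: "'a::complex_normed_vector set"
  assumes Y: "csubspace Y"
    and w: "w \<in> Bidual" "\<And>g. g \<in> Dual \<Longrightarrow> (\<And>y. y \<in> Y \<Longrightarrow> g y = 0) \<Longrightarrow> w g = 0"
    and F: "finite F" "F \<noteq> {}" and r: "\<And>e. e \<in> F \<Longrightarrow> Bidual_norm (embed e + w) \<le> r" "r < r'"
    and \<phi>: "\<phi> \<in> Dual" "w \<phi> \<noteq> 0" and K: "0 < K"
  obtains z where "z \<in> Y" "\<And>e. e \<in> F \<Longrightarrow> norm (e + z) < r'" "K * cmod (\<phi> z - w \<phi>) < r'"
proof -
  have B: "csubspace (Bidual :: (('a \<Rightarrow> complex) \<Rightarrow> complex) set)" by (rule csubspace_dual)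
  have wmap: "w (c *\<^sub>C f) = c * w f" if "f \<in> Dual" for c f using dual_clinear(2)[OF w(1) that] .
  have "w 0 = 0" using wmap[OF \<phi>(1), of 0] by simp
  have "\<exists>x1. \<phi> x1 \<noteq> 0"
  proof (rule ccontr)
    assume "\<not> ?thesis"
    then have "\<phi> = 0" by auto
    then show False using \<phi>(2) \<open>w 0 = 0\<close> by simp
  qed
  then obtain x1 where x1: "\<phi> x1 \<noteq> 0" by blast
  \<comment> \<open>A point at which \<open>\<phi>\<close> takes the value \<open>w \<phi>\<close>
    turns the condition on \<open>\<phi> z\<close> into closeness of \<open>z\<close> to
    \<open>x0\<close> in the seminorm \<open>K * cmod (\<phi> x)\<close>.\<close>
  define x0 where "x0 = (w \<phi> / \<phi> x1) *\<^sub>C x1"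
  have x0: "\<phi> x0 = w \<phi>" using x1 dual_clinear(2)[OF \<phi>(1)] by (simp add: x0_def)
  \<comment> \<open>\<open>Some e\<close> carries the norm and the point \<open>e\<close>; the extra
    index \<open>None\<close> carries the degenerate seminorm and the point \<open>- x0\<close>. The
    sign is negative because the answer is \<open>z = - y\<close>.\<close>
  let ?I = "insert None (Some ` F)"
  define N where "N = case_option (\<lambda>x::'a. K * cmod (\<phi> x)) (\<lambda>e::'a. norm)"
  define a where "a = case_option (- x0) (\<lambda>e. e)"
  have N: "seminorm_on UNIV (N i)" for i
  proof (cases i)
    case None
    have "K * cmod (\<phi> x + \<phi> y) \<le> K * cmod (\<phi> x) + K * cmod (\<phi> y)" for x y
      using mult_left_mono[OF norm_triangle_ineq[of "\<phi> x" "\<phi> y"], of K] K by (simp add: distrib_left)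
    then show ?thesis using None
      by (auto simp: N_def seminorm_on_def dual_clinear[OF \<phi>(1)] norm_mult)
  next
    case (Some e) then show ?thesis using seminorm_on_norm by (simp add: N_def)
  qed
  have I: "finite ?I" "?I \<noteq> {}" using F by auto
  obtain g where g: "\<And>i. i \<in> ?I \<Longrightarrow> g i \<in> dual UNIV (N i)"
    and g_le: "\<And>i x. i \<in> ?I \<Longrightarrow> x \<in> UNIV \<Longrightarrow> cmod (g i x) \<le> N i x"
    and g_Y: "\<And>y. y \<in> Y \<Longrightarrow> (\<Sum>i\<in>?I. g i y) = 0"
    and g_sum: "\<And>u s. (\<And>i. i \<in> ?I \<Longrightarrow> u i \<in> UNIV \<and> N i (u i) \<le> s) \<Longrightarrow> (\<Sum>i\<in>?I. cmod (g i (u i))) \<le> s"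
    and g_a: "\<And>\<eta>. \<eta> > 0 \<Longrightarrow> \<exists>y\<in>Y. \<forall>i\<in>?I. N i (a i - y) < (\<Sum>i\<in>?I. Re (g i (a i))) + \<eta>"
    by (rule tuple_distance_duality[of UNIV ?I N Y a, OF csubspace_UNIV I N Y subset_UNIV UNIV_I])
      blast
  have sum_I: "(\<Sum>i\<in>?I. h i) = h None + (\<Sum>e\<in>F. h (Some e))" for h :: "'a option \<Rightarrow> 'b::comm_monoid_add"
    using F(1) by (subst sum.insert) (auto simp: sum.reindex)
  have g_Some: "g (Some e) \<in> Dual" if "e \<in> F" for e using g[of "Some e"] that by (simp add: N_def)
  have g_None_le: "cmod (g None x) \<le> K * cmod (\<phi> x)" for x using g_le[of None x] by (simp add: N_def)
  \<comment> \<open>Dominated by a multiple of \<open>cmod (\<phi> x)\<close>, this component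
    vanishes on the kernel of \<open>\<phi>\<close> and is a multiple of \<open>\<phi>\<close>; so
    \<open>w\<close> acts on it as evaluation at \<open>x0\<close>.\<close>
  have g_None: "g None = (g None x0 / w \<phi>) *\<^sub>C \<phi>"
  proof
    fix x
    let ?c = "\<phi> x / w \<phi>"
    have "\<phi> (x - ?c *\<^sub>C x0) = 0"
      using dual_diff[OF csubspace_UNIV \<phi>(1), of x "?c *\<^sub>C x0"] dual_clinear(2)[OF \<phi>(1), of x0 ?c] x0 \<phi>(2)
      by simp
    then have "g None (x - ?c *\<^sub>C x0) = 0" using g_None_le[of "x - ?c *\<^sub>C x0"] by simp
    then have "g None x = ?c * g None x0"
      using dual_diff[OF csubspace_UNIV g[of None], of x "?c *\<^sub>C x0"]
        dual_clinear(2)[OF g[of None], of x0 ?c] by simp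
    then show "g None x = ((g None x0 / w \<phi>) *\<^sub>C \<phi>) x"
      by (simp add: scaleC_fun_def scaleC_complex_def)
  qed
  have g_None_Dual: "g None \<in> Dual"
    using complex_vector.subspace_scale[OF csubspace_dual \<phi>(1)] g_None by metis
  have w_None: "w (g None) = g None x0"
  proof -
    have "w (g None) = g None x0 / w \<phi> * w \<phi>" by (subst g_None) (rule wmap[OF \<phi>(1)])
    then show ?thesis using \<phi>(2) by simp
  qed
  have g_Dual: "g i \<in> Dual" if "i \<in> ?I" for i using that g_None_Dual g_Some by auto
  have "w (sum g ?I) = 0"
  proof (rule w(2))
    show "sum g ?I \<in> Dual" using g_Dual by (rule sum_in_dual)
    show "sum g ?I y = 0" if "y \<in> Y" for y using g_Y[OF that] by (simp only: sum_fun_apply)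
  qed
  then have "(\<Sum>i\<in>?I. w (g i)) = 0"
    using dual_sum[OF csubspace_dual w(1) I(1) g_Dual] by simp
  then have w_sum: "g None x0 = - (\<Sum>e\<in>F. w (g (Some e)))"
    by (simp only: sum_I w_None) (simp add: eq_neg_iff_add_eq_0)
  have norm_sum: "(\<Sum>e\<in>F. Dual_norm (g (Some e))) \<le> 1"
  proof (rule sum_dual_norm_le[OF csubspace_UNIV seminorm_on_norm F(1)])
    fix u :: "'a \<Rightarrow> 'a" assume u: "\<And>i. i \<in> F \<Longrightarrow> u i \<in> UNIV \<and> norm (u i) \<le> 1"
    have "\<phi> 0 = 0" using dual_clinear(2)[OF \<phi>(1), of 0 0] by simp
    then have "(\<Sum>i\<in>?I. cmod (g i (case_option 0 u i))) \<le> 1"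
      using u by (intro g_sum) (auto simp: N_def)
    then show "(\<Sum>i\<in>F. cmod (g (Some i) (u i))) \<le> 1"
      unfolding sum_I option.case using norm_ge_zero[of "g None 0"] by linarith
  qed
  obtain e0 where "e0 \<in> F" using F by blast
  have ew: "embed e + w \<in> Bidual" for e
    using B embed_in_Bidual w(1) by (rule complex_vector.subspace_add)
  have r0: "0 \<le> r"
    using r(1)[OF \<open>e0 \<in> F\<close>] seminorm_on_nonneg[OF B seminorm_on_Bidual_norm ew, of e0] by simp
  \<comment> \<open>As \<open>w\<close> kills the sum of all components, the term at
    \<open>None\<close> can be traded for the values \<open>w (g (Some e))\<close>, which complete
    the evaluations at \<open>e\<close> to those of \<open>embed e + w\<close>.\<close>
  have "(\<Sum>i\<in>?I. Re (g i (a i))) = Re (- g None x0) + (\<Sum>e\<in>F. Re (g (Some e) e))"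
    using dual_minus[OF csubspace_UNIV g[of None], of x0] by (simp only: sum_I) (simp add: a_def)
  also have "\<dots> = (\<Sum>e\<in>F. Re ((embed e + w) (g (Some e))))"
    using w_sum by (simp add: embed_apply g_Some sum.distrib)
  also have "\<dots> \<le> (\<Sum>e\<in>F. Dual_norm (g (Some e)) * r)"
  proof (rule sum_mono)
    fix e assume e: "e \<in> F"
    have "Re ((embed e + w) (g (Some e))) \<le> Bidual_norm (embed e + w) * Dual_norm (g (Some e))"
      using complex_Re_le_cmod norm_dual_le[OF csubspace_dual seminorm_on_Dual_norm ew g_Some[OF e]]
        order_trans by blast
    also have "\<dots> \<le> r * Dual_norm (g (Some e))"
      using r(1)[OF e] dual_norm_nonneg[OF csubspace_UNIV seminorm_on_norm g_Some[OF e]]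
      by (rule mult_right_mono)
    finally show "Re ((embed e + w) (g (Some e))) \<le> Dual_norm (g (Some e)) * r"
      by (simp add: mult.commute)
  qed
  also have "\<dots> \<le> r"
    using mult_right_mono[OF norm_sum r0] by (simp add: sum_distrib_right)
  finally have le: "(\<Sum>i\<in>?I. Re (g i (a i))) \<le> r" .
  obtain y where y: "y \<in> Y" "\<forall>i\<in>?I. N i (a i - y) < (\<Sum>i\<in>?I. Re (g i (a i))) + (r' - r)"
    using g_a[of "r' - r"] r(2) by auto
  have y_lt: "N i (a i - y) < r'" if "i \<in> ?I" for i using y(2) that le by force
  show thesis
  proof (rule that[of "- y"])
    show "- y \<in> Y" using Y y(1) by (rule complex_vector.subspace_neg)
    show "norm (e + - y) < r'" if "e \<in> F" for e
      using y_lt[of "Some e"] that by (simp add: N_def a_def)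
    have "\<phi> (- x0 - y) = \<phi> (- y) - w \<phi>"
      using dual_diff[OF csubspace_UNIV \<phi>(1), of "- y" x0] x0
      by (metis UNIV_I add.commute diff_conv_add_uminus)
    then show "K * cmod (\<phi> (- y) - w \<phi>) < r'" using y_lt[of None] by (simp add: N_def a_def)
  qed
qed

section \<open>Construction of a single block\<close>

text \<open>Points of \<open>Y\<close> approximating \<open>\<theta>\<close> would be Cauchy since
  the embedding is isometric, and the image of their limit, which lies in \<open>Y\<close>, would be
  \<open>\<theta>\<close>.\<close>

lemma Bidual_dist_pos:
  fixes Y :: "'a::complex_banach set"
  assumes Y: "closed Y" and \<theta>: "\<theta> \<in> Bidual" "\<theta> \<notin> embed ` Y"
  obtains d where "d > 0" "\<And>y. y \<in> Y \<Longrightarrow> d \<le> Bidual_norm (\<theta> - embed y)"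
proof (rule ccontr)
  assume none: "\<not> thesis"
  note B = csubspace_dual[of Dual "Dual_norm :: ('a \<Rightarrow> complex) \<Rightarrow> real"]
  note tri = seminorm_on_dist_triangle[OF B seminorm_on_Bidual_norm]
  note comm = seminorm_on_diff_commute[OF B seminorm_on_Bidual_norm]
  have "\<exists>y\<in>Y. Bidual_norm (\<theta> - embed y) < inverse (real (Suc n))" for n
    using none that[of "inverse (real (Suc n))"] by (force simp: not_le)
  then obtain y where y: "\<And>n. y n \<in> Y" "\<And>n. Bidual_norm (\<theta> - embed (y n)) < inverse (real (Suc n))"
    by metis
  have dist: "norm (x - x') \<le> Bidual_norm (\<theta> - embed x) + Bidual_norm (\<theta> - embed x')" for x x' :: 'a
  proof -
    have "norm (x - x') = Bidual_norm (embed x - embed x')"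
      by (simp only: embed_linear(3)[symmetric] Bidual_norm_embed)
    also have "\<dots> \<le> Bidual_norm (embed x - \<theta>) + Bidual_norm (\<theta> - embed x')"
      using embed_in_Bidual \<theta>(1) by (intro tri) auto
    also have "Bidual_norm (embed x - \<theta>) = Bidual_norm (\<theta> - embed x)"
      using embed_in_Bidual \<theta>(1) by (intro comm) auto
    finally show ?thesis .
  qed
  have "Cauchy y"
  proof (rule metric_CauchyI)
    fix e :: real assume "e > 0"
    then obtain M where M: "inverse (real (Suc M)) < e / 2" using reals_Archimedean[of "e / 2"] by auto
    have small: "Bidual_norm (\<theta> - embed (y n)) < e / 2" if "n \<ge> M" for n
      using y(2)[of n] M that
      by (smt (verit) inverse_le_iff_le of_nat_0_less_iff of_nat_le_iff Suc_le_mono zero_less_Suc)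
    have "dist (y m) (y n) < e" if "m \<ge> M" "n \<ge> M" for m n
      using dist[of "y m" "y n"] small[OF that(1)] small[OF that(2)] by (simp add: dist_norm)
    then show "\<exists>M. \<forall>m\<ge>M. \<forall>n\<ge>M. dist (y m) (y n) < e" by blast
  qed
  then obtain l where l: "y \<longlonglongrightarrow> l" using Cauchy_convergent convergent_def by blast
  have lY: "l \<in> Y" using closed_sequentially[OF Y] y(1) l by blast
  have "(\<lambda>n. inverse (real (Suc n)) + norm (y n - l)) \<longlonglongrightarrow> 0 + 0"
    using l by (intro tendsto_add LIMSEQ_inverse_real_of_nat tendsto_norm_zero LIM_zero)
  then have lim: "(\<lambda>n. inverse (real (Suc n)) + norm (y n - l)) \<longlonglongrightarrow> 0" by simp
  have le: "Bidual_norm (\<theta> - embed l) \<le> inverse (real (Suc n)) + norm (y n - l)" for n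
  proof -
    have "Bidual_norm (\<theta> - embed l) \<le> Bidual_norm (\<theta> - embed (y n)) + Bidual_norm (embed (y n) - embed l)"
      using embed_in_Bidual \<theta>(1) by (intro tri) auto
    also have "Bidual_norm (embed (y n) - embed l) = norm (y n - l)"
      by (simp only: embed_linear(3)[symmetric] Bidual_norm_embed)
    finally show ?thesis using y(2)[of n] by linarith
  qed
  have "Bidual_norm (\<theta> - embed l) \<le> 0"
    using le by (intro LIMSEQ_le_const[OF lim]) blast
  moreover have diff: "\<theta> - embed l \<in> Bidual"
    using complex_vector.subspace_diff[OF B \<theta>(1) embed_in_Bidual] .
  ultimately have "\<theta> - embed l = 0"
    using seminorm_on_nonneg[OF B seminorm_on_Bidual_norm diff]
    by (intro dual_norm_eq_0_imp[OF csubspace_dual seminorm_on_Dual_norm diff]) simp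
  then show False using \<theta>(2) lY by simp
qed

text \<open>Keeps the adjustments of \<open>\<theta>\<close> below, scaling and translation by
  \<open>Y\<close>, inside the bipolar of \<open>Y\<close>.\<close>

lemma bipolar_scale_shift:
  assumes Y: "csubspace Y" and w: "w \<in> Bidual" and y: "y \<in> Y"
    and w0: "\<And>g. g \<in> Dual \<Longrightarrow> (\<And>y. y \<in> Y \<Longrightarrow> g y = 0) \<Longrightarrow> w g = 0"
  shows "c *\<^sub>C (w - embed y) \<in> Bidual"
    and "\<And>g. g \<in> Dual \<Longrightarrow> (\<And>y. y \<in> Y \<Longrightarrow> g y = 0) \<Longrightarrow> (c *\<^sub>C (w - embed y)) g = 0"
  using complex_vector.subspace_scale[OF csubspace_dual
      complex_vector.subspace_diff[OF csubspace_dual w embed_in_Bidual]] w0 y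
  by (auto simp: scaleC_fun_def scaleC_complex_def embed_apply)

text \<open>Finiteness of \<open>F\<close> leaves a positive margin below 1, which is shared between
  the two ball intersections, first in the bidual and then in \<open>Y\<close>.\<close>

lemma M_embedded_block_extension:
  fixes Y :: "'a::complex_banach set"
  assumes emb: "M_embedded (UNIV :: 'a set) norm" and Y: "csubspace Y" "closed Y"
    and nonref: "\<not> reflexive Y norm"
    and F: "finite F" "F \<subseteq> Y" "\<And>e. e \<in> F \<Longrightarrow> norm e < 1" and \<epsilon>: "\<epsilon> > 0"
  obtains x where "x \<in> Y" "\<And>e. e \<in> F \<Longrightarrow> norm (e + x) < 1" "\<And>e. e \<in> F \<Longrightarrow> norm (e - x) < 1"
    "1 - \<epsilon> < norm x"
proof -
  note B = csubspace_dual[of Dual "Dual_norm :: ('a \<Rightarrow> complex) \<Rightarrow> real"]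
  note B_scale = seminorm_on_scale[OF seminorm_on_Bidual_norm]
  \<comment> \<open>The negatives let one estimate cover both signs of \<open>x\<close>; the element
    0 makes the set nonempty.\<close>
  define F' where "F' = insert 0 (F \<union> uminus ` F)"
  have F': "finite F'" "F' \<noteq> {}" using F(1) by (auto simp: F'_def)
  define m where "m = Max (norm ` F')"
  have "m \<in> norm ` F'" using F' by (auto simp: m_def)
  then have "m < 1" using F(3) by (auto simp: F'_def)
  have m_ge: "norm e \<le> m" if "e \<in> F'" for e using F' that by (auto simp: m_def)
  \<comment> \<open>Passing to \<open>w\<close> and then to \<open>z\<close> costs
    \<open>\<delta> / 2\<close> each in the upper bounds. In the lower bound, \<open>w\<close> loses
    \<open>2 * \<delta>\<close> and \<open>\<phi> z\<close> another \<open>\<delta>\<close>,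
    together at most \<open>3 * \<epsilon> / 4\<close>; the bound 1/4 keeps \<open>w \<phi>\<close>
    away from 0.\<close>
  define \<delta> where "\<delta> = Min {1 - m, \<epsilon> / 4, 1 / 4}"
  have \<delta>: "0 < \<delta>" "\<delta> \<le> 1 - m" "\<delta> \<le> \<epsilon> / 4" "\<delta> \<le> 1 / 4"
  proof -
    show "0 < \<delta>" using \<open>m < 1\<close> \<epsilon> by (simp add: \<delta>_def)
  qed (unfold \<delta>_def, (rule Min.coboundedI; simp)+)
  obtain \<theta> where \<theta>: "\<theta> \<in> Bidual" "\<theta> \<notin> embed ` Y"
    "\<And>g. g \<in> Dual \<Longrightarrow> (\<And>y. y \<in> Y \<Longrightarrow> g y = 0) \<Longrightarrow> \<theta> g = 0"
    using nonreflexive_functional[OF Y(1) nonref] by metis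
  define d where "d = (INF y\<in>Y. Bidual_norm (\<theta> - embed y))"
  have Y0: "0 \<in> Y" using Y(1) by (rule complex_vector.subspace_0)
  obtain d' where d': "d' > 0" "\<And>y. y \<in> Y \<Longrightarrow> d' \<le> Bidual_norm (\<theta> - embed y)"
    using Bidual_dist_pos[OF Y(2) \<theta>(1,2)] by blast
  have "d' \<le> d" unfolding d_def using Y0 d'(2) by (intro cINF_greatest) auto
  then have d0: "d > 0" using d'(1) by simp
  have d_le: "d \<le> Bidual_norm (\<theta> - embed y)" if "y \<in> Y" for y
    unfolding d_def using that d'(2) by (intro cINF_lower bdd_belowI[of _ d']) auto
  \<comment> \<open>The factor exceeds 1, so some \<open>y0\<close> nearly realises the distance;
    one scaling then gives norm \<open>1 - \<delta>\<close> and distance above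
    \<open>1 - 2 * \<delta>\<close>.\<close>
  have "d * 1 < d * ((1 - \<delta>) / (1 - 2 * \<delta>))"
    using d0 \<delta> by (intro mult_strict_left_mono) (auto simp: field_simps)
  then obtain y0 where y0: "y0 \<in> Y" "Bidual_norm (\<theta> - embed y0) < d * ((1 - \<delta>) / (1 - 2 * \<delta>))"
    unfolding d_def using Y0 d'(2) by (subst (asm) mult_1_right, subst (asm) (1) cINF_less_iff)
      (auto intro!: bdd_belowI[of _ d'])
  define b where "b = Bidual_norm (\<theta> - embed y0)"
  have b: "0 < b" "b * (1 - 2 * \<delta>) < d * (1 - \<delta>)"
    using d_le[OF y0(1)] d0 y0(2) \<delta> by (auto simp: b_def field_simps)
  define c where "c = (1 - \<delta>) / b"
  have c: "c > 0" "c * b = 1 - \<delta>" "1 - 2 * \<delta> < c * d"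
    using b \<delta> by (auto simp: c_def field_simps)
  define \<theta>' where "\<theta>' = complex_of_real c *\<^sub>C (\<theta> - embed y0)"
  have \<theta>': "\<theta>' \<in> Bidual" "\<And>g. g \<in> Dual \<Longrightarrow> (\<And>y. y \<in> Y \<Longrightarrow> g y = 0) \<Longrightarrow> \<theta>' g = 0"
    unfolding \<theta>'_def using bipolar_scale_shift[OF Y(1) \<theta>(1) y0(1) \<theta>(3)] by blast+
  have diffB: "\<theta> - embed y \<in> Bidual" for y
    using complex_vector.subspace_diff[OF B \<theta>(1) embed_in_Bidual] .
  have "Bidual_norm \<theta>' = 1 - \<delta>"
    unfolding \<theta>'_def using B_scale[OF diffB] c by (simp add: b_def)
  then have \<theta>'_le: "Bidual_norm \<theta>' \<le> 1 - \<delta>" by simp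
  have e_le: "norm e \<le> 1 - \<delta>" if "e \<in> F'" for e using m_ge[OF that] \<delta>(2) by simp
  have "1 - \<delta> < 1 - \<delta> / 2" using \<delta> by simp
  then obtain y where y: "y \<in> Y" "\<And>e. e \<in> F' \<Longrightarrow> Bidual_norm (embed e + \<theta>' - embed y) < 1 - \<delta> / 2"
    using M_embedded_ball_intersection[OF emb Y(1) \<theta>' F' e_le \<theta>'_le] by metis
  \<comment> \<open>The factor 1 is there to match \<open>bipolar_scale_shift\<close>.\<close>
  define w where "w = 1 *\<^sub>C (\<theta>' - embed y)"
  have w: "w \<in> Bidual" "\<And>g. g \<in> Dual \<Longrightarrow> (\<And>y. y \<in> Y \<Longrightarrow> g y = 0) \<Longrightarrow> w g = 0"
    unfolding w_def using bipolar_scale_shift[OF Y(1) \<theta>'(1) y(1) \<theta>'(2)] by blast+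
  have w_eq: "w = \<theta>' - embed y" by (simp add: w_def scaleC_one)
  have ew: "Bidual_norm (embed e + w) \<le> 1 - \<delta> / 2" if "e \<in> F'" for e
    using y(2)[OF that] by (simp add: w_eq add_diff_eq)
  \<comment> \<open>Undoing the scaling shows \<open>w\<close> as \<open>c\<close> times a point of
    \<open>\<theta> + Y\<close>, so its norm is at least \<open>c * d\<close>.\<close>
  have "1 - 2 * \<delta> < Bidual_norm w"
  proof -
    let ?y = "y0 + complex_of_real (1 / c) *\<^sub>C y"
    have "w = complex_of_real c *\<^sub>C (\<theta> - embed ?y)"
      using c(1) by (simp add: w_eq \<theta>'_def embed_linear complex_vector.scale_right_diff_distrib
          scaleC_add_right)
    then have "Bidual_norm w = c * Bidual_norm (\<theta> - embed ?y)"
      using B_scale[OF diffB, of "complex_of_real c" ?y] c(1) by simp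
    moreover have "?y \<in> Y"
      using y0(1) y(1) complex_vector.subspace_add[OF Y(1)] complex_vector.subspace_scale[OF Y(1)] by blast
    then have "c * d \<le> c * Bidual_norm (\<theta> - embed ?y)" using c(1) d_le by simp
    ultimately show ?thesis using c(3) by simp
  qed
  then obtain \<phi> where \<phi>: "\<phi> \<in> Dual" "Dual_norm \<phi> \<le> 1" "1 - 2 * \<delta> < cmod (w \<phi>)"
  proof -
    assume lt: "1 - 2 * \<delta> < Bidual_norm w" and *: "\<And>\<phi>. \<phi> \<in> Dual \<Longrightarrow> Dual_norm \<phi> \<le> 1 \<Longrightarrow>
      1 - 2 * \<delta> < cmod (w \<phi>) \<Longrightarrow> thesis"
    have "Bidual_norm w \<le> 1 - 2 * \<delta>" if none: "\<And>\<phi>. \<phi> \<in> Dual \<Longrightarrow> Dual_norm \<phi> \<le> 1 \<Longrightarrow> cmod (w \<phi>) \<le> 1 - 2 * \<delta>"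
      unfolding dual_norm_def[of Dual]
    proof (rule cSUP_least)
      have "(0 :: 'a \<Rightarrow> complex) \<in> Dual" by (rule complex_vector.subspace_0[OF csubspace_dual])
      moreover have "Dual_norm (0 :: 'a \<Rightarrow> complex) = 0"
        by (rule seminorm_on_zero[OF csubspace_dual seminorm_on_Dual_norm])
      ultimately have "(0 :: 'a \<Rightarrow> complex) \<in> {f \<in> Dual. Dual_norm f \<le> 1}" by simp
      then show "{f \<in> Dual. Dual_norm (f :: 'a \<Rightarrow> complex) \<le> 1} \<noteq> {}" by blast
    qed (use none in auto)
    then show thesis using lt * by (meson not_le)
  qed
  have w\<phi>: "w \<phi> \<noteq> 0" using \<phi>(3) \<delta>(4) by auto
  \<comment> \<open>With weight \<open>1 / \<delta>\<close> and radius 1, the condition on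
    \<open>\<phi>\<close> says that \<open>\<phi> z\<close> is within \<open>\<delta>\<close> of
    \<open>w \<phi>\<close>.\<close>
  have "1 - \<delta> / 2 < 1" "0 < 1 / \<delta>" using \<delta>(1) by auto
  then obtain z where z: "z \<in> Y" "\<And>e. e \<in> F' \<Longrightarrow> norm (e + z) < 1" "1 / \<delta> * cmod (\<phi> z - w \<phi>) < 1"
    using Helly_ball_intersection[OF Y(1) w F' ew _ \<phi>(1) w\<phi>] by metis
  have "cmod (\<phi> z - w \<phi>) < \<delta>" using z(3) \<delta>(1) by (simp add: field_simps)
  then have "1 - 3 * \<delta> < cmod (\<phi> z)"
    using \<phi>(3) norm_triangle_sub[of "w \<phi>" "\<phi> z"] by (simp add: norm_minus_commute)
  also have "\<dots> \<le> Dual_norm \<phi> * norm z"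
    using norm_dual_le[OF csubspace_UNIV seminorm_on_norm \<phi>(1)] by blast
  also have "\<dots> \<le> 1 * norm z" using \<phi>(2) by (rule mult_right_mono) simp
  finally have "1 - \<epsilon> < norm z" using \<delta> by simp
  moreover have "norm (e + z) < 1" "norm (e - z) < 1" if "e \<in> F" for e
  proof -
    show "norm (e + z) < 1" using z(2)[of e] that by (simp add: F'_def)
    show "norm (e - z) < 1" using z(2)[of "- e"] that by (simp add: F'_def norm_minus_commute)
  qed
  ultimately show thesis using that z(1) by blast
qed

subsection \<open>Asymptotically isometric copies of \<open>c\<^sub>0\<close>\<close>

text \<open>A null sequence reaches the positive value \<open>v j\<close> only finitely often.
  Attainment matters later: strict comparison of terms does not give strict comparison of
  suprema.\<close>

lemma tendsto_zero_attains_max: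
  fixes v :: "nat \<Rightarrow> real"
  assumes lim: "v \<longlonglongrightarrow> 0" and j: "v j > 0"
  obtains m where "\<And>i. v i \<le> v m" "v m > 0"
proof -
  obtain N where N: "\<And>i. i \<ge> N \<Longrightarrow> v i < v j"
    using order_tendstoD(2)[OF lim j] by (auto simp: eventually_sequentially)
  let ?A = "v ` {..max N j}"
  have "Max ?A \<in> ?A" by (rule Max_in) auto
  then obtain m where m: "v m = Max ?A" by (metis imageE)
  have le: "v i \<le> v m" if "i \<le> max N j" for i using that by (auto simp: m)
  have "v i \<le> v m" for i
  proof (cases "i \<le> max N j")
    case False
    then have "v i < v j" using N by simp
    also have "v j \<le> v m" by (rule le) simp
    finally show ?thesis by simp
  qed (rule le)
  moreover have "v m > 0" using le[of j] j by simp
  ultimately show thesis using that by blast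
qed

text \<open>
  Weights with \<open>\<Prod>\<^sub>i c0_weight i = 1/2 > 0\<close>: an orbit of the weighted shift that starts in \<open>1\<close>
  does not tend to \<open>0\<close>.
\<close>

definition c0_weight :: "nat \<Rightarrow> real" where
  "c0_weight n = 1 - 1 / (real n + 2)\<^sup>2"

text \<open>The factored form telescopes: the product of the first n weights is
  \<open>(n + 2) / (2 * (n + 1))\<close>.\<close>

lemma c0_weight_eq: "c0_weight n = (real n + 1) * (real n + 3) / (real n + 2)\<^sup>2"
proof -
  have "(real n + 2)\<^sup>2 > 0" by (simp add: add_pos_pos zero_less_power)
  then show ?thesis unfolding c0_weight_def
    by (simp add: divide_simps) (simp add: power2_eq_square algebra_simps)
qed

lemma c0_weight_pos: "0 < c0_weight n" and c0_weight_le: "c0_weight n \<le> 1"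
proof -
  show "0 < c0_weight n" unfolding c0_weight_eq by (intro divide_pos_pos mult_pos_pos zero_less_power) auto
qed (simp add: c0_weight_def)

section \<open>The weighted shift on an asymptotically isometric copy of c0\<close>

text \<open>The estimates concern finite real sums, so they can be verified before any convergence
  is known. \<open>b_ge\<close> makes the coefficients Lipschitz in the vector, uniformly in the
  index; \<open>b_gt\<close> is the margin for the contractive shift.\<close>

locale c0_sequence =
  fixes x :: "nat \<Rightarrow> 'a::banach" and b :: "nat \<Rightarrow> real"
  assumes upper: "\<And>n r M. 0 \<le> M \<Longrightarrow> (\<And>i. i < n \<Longrightarrow> \<bar>r i\<bar> \<le> M) \<Longrightarrow> norm (\<Sum>i<n. r i *\<^sub>R x i) \<le> M"
    and lower: "\<And>n r k. k < n \<Longrightarrow> b k * \<bar>r k\<bar> \<le> norm (\<Sum>i<n. r i *\<^sub>R x i)"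
    and b_ge: "\<And>k. 1 / 2 \<le> b k"
    and b_gt: "\<And>k. c0_weight k < b k"
begin

lemma summable_c0:
  assumes "r \<longlonglongrightarrow> 0"
  shows "summable (\<lambda>i. r i *\<^sub>R x i)"
  unfolding summable_Cauchy
proof (intro allI impI)
  fix e :: real assume e: "0 < e"
  obtain N where N: "\<And>i. i \<ge> N \<Longrightarrow> \<bar>r i\<bar> < e / 2"
    using LIMSEQ_D[OF assms, of "e / 2"] e by auto
  have "norm (sum (\<lambda>i. r i *\<^sub>R x i) {m..<n}) < e" if "m \<ge> N" for m n
  proof -
    have "sum (\<lambda>i. r i *\<^sub>R x i) {m..<n} = (\<Sum>i<n. (if m \<le> i then r i else 0) *\<^sub>R x i)"
      by (intro sum.mono_neutral_cong_left) auto
    also have "norm \<dots> \<le> e / 2"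
      using N that e by (intro upper) (auto simp: less_imp_le)
    finally show ?thesis using e by simp
  qed
  then show "\<exists>N. \<forall>m\<ge>N. \<forall>n. norm (sum (\<lambda>i. r i *\<^sub>R x i) {m..<n}) < e" by blast
qed

definition synth :: "(nat \<Rightarrow> real) \<Rightarrow> 'a" where
  "synth r = (\<Sum>i. r i *\<^sub>R x i)"

lemma synth_lim: "r \<longlonglongrightarrow> 0 \<Longrightarrow> (\<lambda>n. \<Sum>i<n. r i *\<^sub>R x i) \<longlonglongrightarrow> synth r"
  unfolding synth_def using summable_c0 by (rule summable_LIMSEQ)

lemma synth_upper:
  assumes "r \<longlonglongrightarrow> 0" "\<And>i. \<bar>r i\<bar> \<le> M"
  shows "norm (synth r) \<le> M"
proof (rule LIMSEQ_le_const2[OF tendsto_norm[OF synth_lim[OF assms(1)]]])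
  have "0 \<le> M" using assms(2)[of 0] by linarith
  then show "\<exists>N. \<forall>n\<ge>N. norm (\<Sum>i<n. r i *\<^sub>R x i) \<le> M" using upper assms(2) by blast
qed

lemma synth_lower: "r \<longlonglongrightarrow> 0 \<Longrightarrow> b k * \<bar>r k\<bar> \<le> norm (synth r)"
  by (rule LIMSEQ_le_const[OF tendsto_norm[OF synth_lim]])
    (auto intro!: exI[of _ "Suc k"] lower)

lemma synth_linear:
  assumes "r \<longlonglongrightarrow> 0" "s \<longlonglongrightarrow> 0"
  shows "synth (\<lambda>i. c * r i + d * s i) = c *\<^sub>R synth r + d *\<^sub>R synth s"
proof -
  have "(\<lambda>i. c *\<^sub>R r i *\<^sub>R x i + d *\<^sub>R s i *\<^sub>R x i) sums (c *\<^sub>R synth r + d *\<^sub>R synth s)"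
    unfolding synth_def using assms summable_c0
    by (intro sums_add sums_scaleR_right summable_sums)
  then show ?thesis unfolding synth_def by (simp add: scaleR_add_left sums_unique[symmetric])
qed

lemma synth_diff:
  assumes "r \<longlonglongrightarrow> 0" "s \<longlonglongrightarrow> 0"
  shows "synth (\<lambda>i. r i - s i) = synth r - synth s"
  using synth_linear[OF assms, of 1 "- 1"] by simp

definition unit_coeffs :: "(nat \<Rightarrow> real) set" where
  "unit_coeffs = {r. r \<longlonglongrightarrow> 0 \<and> (\<forall>i. 0 \<le> r i \<and> r i \<le> 1)}"

lemma coeff_dist:
  assumes "r \<longlonglongrightarrow> 0" "s \<longlonglongrightarrow> 0"
  shows "\<bar>r i - s i\<bar> \<le> 2 * norm (synth r - synth s)"
proof -
  have lim: "(\<lambda>i. r i - s i) \<longlonglongrightarrow> 0" using tendsto_diff[OF assms] by simp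
  have "1 / 2 * \<bar>r i - s i\<bar> \<le> b i * \<bar>r i - s i\<bar>" using b_ge by (intro mult_right_mono) auto
  also have "\<dots> \<le> norm (synth r - synth s)" using synth_lower[OF lim, of i] synth_diff[OF assms] by simp
  finally show ?thesis by simp
qed

text \<open>By \<open>coeff_dist\<close> a convergent sequence of vectors has uniformly Cauchy
  coefficients, and a uniform limit of null sequences is null; \<open>synth_upper\<close> leads back
  to the vectors.\<close>

lemma closed_synth_image: "closed (synth ` unit_coeffs)"
  unfolding closed_sequential_limits
proof (intro allI impI, elim conjE)
  fix y l assume y: "\<forall>k. y k \<in> synth ` unit_coeffs" and l: "y \<longlonglongrightarrow> l"
  then have "\<forall>k. \<exists>r. r \<in> unit_coeffs \<and> y k = synth r" by blast
  then obtain r where r: "\<And>k. r k \<in> unit_coeffs" and yr: "\<And>k. y k = synth (r k)" by metis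
  have r0: "r k \<longlonglongrightarrow> 0" and r01: "0 \<le> r k i" "r k i \<le> 1" for k i
    using r by (auto simp: unit_coeffs_def)
  have Cauchy: "\<exists>N. \<forall>k\<ge>N. \<forall>m\<ge>N. \<forall>i. \<bar>r k i - r m i\<bar> < e" if e: "e > 0" for e
  proof -
    obtain N where N: "\<And>k m. k \<ge> N \<Longrightarrow> m \<ge> N \<Longrightarrow> norm (y k - y m) < e / 2"
      using metric_CauchyD[OF LIMSEQ_imp_Cauchy[OF l], of "e / 2"] e by (auto simp: dist_norm)
    have "\<bar>r k i - r m i\<bar> < e" if "k \<ge> N" "m \<ge> N" for k m i
      using coeff_dist[OF r0 r0, of k i m] N[OF that] by (simp add: yr)
    then show ?thesis by blast
  qed
  have "convergent (\<lambda>k. r k i)" for i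
  proof (intro Cauchy_convergent metric_CauchyI)
    fix e :: real assume "e > 0"
    from Cauchy[OF this] show "\<exists>N. \<forall>k\<ge>N. \<forall>m\<ge>N. dist (r k i) (r m i) < e"
      by (auto simp: dist_real_def)
  qed
  then have "\<forall>i. \<exists>s. (\<lambda>k. r k i) \<longlonglongrightarrow> s" by (auto simp: convergent_def)
  then obtain s where s: "\<And>i. (\<lambda>k. r k i) \<longlonglongrightarrow> s i" by metis
  have unif: "\<exists>N. \<forall>k\<ge>N. \<forall>i. \<bar>r k i - s i\<bar> \<le> e" if e: "e > 0" for e
  proof -
    obtain N where N: "\<And>k m i. k \<ge> N \<Longrightarrow> m \<ge> N \<Longrightarrow> \<bar>r k i - r m i\<bar> < e" using Cauchy[OF e] by blast
    have "\<bar>r k i - s i\<bar> \<le> e" if "k \<ge> N" for k i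
    proof (rule LIMSEQ_le_const2)
      show "(\<lambda>m. \<bar>r k i - r m i\<bar>) \<longlonglongrightarrow> \<bar>r k i - s i\<bar>" by (intro tendsto_intros s)
      show "\<exists>N. \<forall>m\<ge>N. \<bar>r k i - r m i\<bar> \<le> e" using N[OF that] by (auto intro: less_imp_le)
    qed
    then show ?thesis by blast
  qed
  have s0: "s \<longlonglongrightarrow> 0"
  proof (rule LIMSEQ_I)
    fix e :: real assume e: "0 < e"
    obtain k where k: "\<And>i. \<bar>r k i - s i\<bar> \<le> e / 2" using unif[of "e / 2"] e by auto
    obtain N where N: "\<And>i. i \<ge> N \<Longrightarrow> \<bar>r k i\<bar> < e / 2" using LIMSEQ_D[OF r0, of "e / 2"] e by auto
    have "norm (s i - 0) < e" if "i \<ge> N" for i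
      using k[of i] N[OF that] unfolding diff_0_right real_norm_def by linarith
    then show "\<exists>N. \<forall>i\<ge>N. norm (s i - 0) < e" by blast
  qed
  have "0 \<le> s i" "s i \<le> 1" for i
    using r01 by (auto intro: LIMSEQ_le_const[OF s] LIMSEQ_le_const2[OF s])
  then have sU: "s \<in> unit_coeffs" using s0 by (simp add: unit_coeffs_def)
  have "y \<longlonglongrightarrow> synth s"
  proof (rule LIMSEQ_I)
    fix e :: real assume e: "0 < e"
    obtain N where N: "\<And>k i. k \<ge> N \<Longrightarrow> \<bar>r k i - s i\<bar> \<le> e / 2" using unif[of "e / 2"] e by auto
    have "norm (y k - synth s) < e" if "k \<ge> N" for k
    proof -
      have "(\<lambda>i. r k i - s i) \<longlonglongrightarrow> 0" using tendsto_diff[OF r0 s0] by simp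
      then have "norm (synth (\<lambda>i. r k i - s i)) \<le> e / 2" using N[OF that] by (rule synth_upper)
      then show ?thesis using e by (simp add: yr synth_diff[OF r0 s0])
    qed
    then show "\<exists>N. \<forall>k\<ge>N. norm (y k - synth s) < e" by blast
  qed
  then have "l = synth s" using l LIMSEQ_unique by blast
  then show "l \<in> synth ` unit_coeffs" using sU by blast
qed

lemma convex_synth_image: "convex (synth ` unit_coeffs)"
proof (rule convexI)
  fix y z and u v :: real
  assume yz: "y \<in> synth ` unit_coeffs" "z \<in> synth ` unit_coeffs" and uv: "0 \<le> u" "0 \<le> v" "u + v = 1"
  then obtain r s where rs: "r \<in> unit_coeffs" "y = synth r" "s \<in> unit_coeffs" "z = synth s" by blast
  then have lim: "r \<longlonglongrightarrow> 0" "s \<longlonglongrightarrow> 0" by (auto simp: unit_coeffs_def)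
  have "(\<lambda>i. u * r i + v * s i) \<longlonglongrightarrow> u * 0 + v * 0" by (intro tendsto_intros lim)
  moreover have "u * r i + v * s i \<le> 1" for i
    using convex_bound_le[of "r i" 1 "s i" u v] rs uv by (auto simp: unit_coeffs_def)
  ultimately have "(\<lambda>i. u * r i + v * s i) \<in> unit_coeffs"
    using rs uv by (auto simp: unit_coeffs_def)
  then show "u *\<^sub>R y + v *\<^sub>R z \<in> synth ` unit_coeffs"
    unfolding rs(2,4) synth_linear[OF lim, symmetric] by (rule imageI)
qed

lemma bounded_synth_image: "bounded (synth ` unit_coeffs)"
  unfolding bounded_iff by (auto simp: unit_coeffs_def intro!: exI[of _ 1] synth_upper)

lemma synth_image_subset:
  assumes Y: "subspace Y" "closed Y" and x: "\<And>n. x n \<in> Y"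
  shows "synth ` unit_coeffs \<subseteq> Y"
proof
  fix y assume "y \<in> synth ` unit_coeffs"
  then obtain r where r: "r \<longlonglongrightarrow> 0" "y = synth r" by (auto simp: unit_coeffs_def)
  have "(\<Sum>i<n. r i *\<^sub>R x i) \<in> Y" for n
    using Y(1) x by (intro subspace_sum subspace_scale) auto
  then show "y \<in> Y" using closed_sequentially[OF Y(2) _ synth_lim[OF r(1)]] r(2) by blast
qed

text \<open>The constant leading entry excludes the fixed point 0 and cancels in
  differences.\<close>

definition weighted_shift :: "(nat \<Rightarrow> real) \<Rightarrow> nat \<Rightarrow> real" where
  "weighted_shift r n = (case n of 0 \<Rightarrow> 1 | Suc m \<Rightarrow> c0_weight m * r m)"

lemma weighted_null:
  assumes "r \<longlonglongrightarrow> 0"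
  shows "(\<lambda>m. c0_weight m * r m) \<longlonglongrightarrow> 0"
proof (rule tendsto_0_le[OF assms, of _ 1])
  show "\<forall>\<^sub>F m in sequentially. norm (c0_weight m * r m) \<le> norm (r m) * 1"
    using c0_weight_le c0_weight_pos
    by (auto simp: abs_mult less_imp_le intro!: always_eventually mult_left_le_one_le)
qed

lemma weighted_shift_null:
  assumes "r \<longlonglongrightarrow> 0"
  shows "weighted_shift r \<longlonglongrightarrow> 0"
proof -
  have "(\<lambda>n. weighted_shift r (Suc n)) \<longlonglongrightarrow> 0"
    using weighted_null[OF assms] by (simp add: weighted_shift_def)
  then show ?thesis by (rule filterlim_sequentially_Suc[THEN iffD1])
qed

lemma weighted_shift_unit_coeffs:
  assumes r: "r \<in> unit_coeffs"
  shows "weighted_shift r \<in> unit_coeffs"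
proof -
  have "0 \<le> weighted_shift r n \<and> weighted_shift r n \<le> 1" for n
    using r c0_weight_pos c0_weight_le
    by (auto simp: weighted_shift_def unit_coeffs_def less_imp_le intro: mult_le_one split: nat.split)
  then show ?thesis using r weighted_shift_null by (simp add: unit_coeffs_def)
qed

text \<open>The weighted differences attain their largest value at some \<open>m\<close>. At this
  index \<open>c0_weight m < b m\<close> is strict, and the single coefficient at \<open>m\<close>
  bounds the norm of the original difference from below.\<close>

lemma weighted_shift_contractive:
  assumes r: "r \<longlonglongrightarrow> 0" and s: "s \<longlonglongrightarrow> 0" and "r \<noteq> s"
  shows "norm (synth (weighted_shift r) - synth (weighted_shift s)) < norm (synth r - synth s)"
proof -
  define v where "v = (\<lambda>m. c0_weight m * \<bar>r m - s m\<bar>)"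
  have rs: "(\<lambda>m. r m - s m) \<longlonglongrightarrow> 0" using tendsto_diff[OF r s] by simp
  then have v: "v \<longlonglongrightarrow> 0" unfolding v_def by (intro weighted_null tendsto_rabs_zero)
  obtain j where "r j \<noteq> s j" using \<open>r \<noteq> s\<close> by blast
  then have "v j > 0" using c0_weight_pos by (simp add: v_def)
  then obtain m where m: "\<And>i. v i \<le> v m" "v m > 0" using tendsto_zero_attains_max[OF v] by blast
  have null: "weighted_shift r \<longlonglongrightarrow> 0" "weighted_shift s \<longlonglongrightarrow> 0" using r s by (auto intro: weighted_shift_null)
  have "\<bar>weighted_shift r i - weighted_shift s i\<bar> \<le> v m" for i
  proof (cases i)
    case 0 then show ?thesis using m(2) by (simp add: weighted_shift_def)
  next
    case (Suc k)
    have "\<bar>weighted_shift r i - weighted_shift s i\<bar> = v k"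
      using Suc c0_weight_pos[of k]
      by (simp add: weighted_shift_def v_def right_diff_distrib[symmetric] abs_mult)
    then show ?thesis using m(1) by simp
  qed
  moreover have "(\<lambda>i. weighted_shift r i - weighted_shift s i) \<longlonglongrightarrow> 0" using tendsto_diff[OF null] by simp
  ultimately have "norm (synth (weighted_shift r) - synth (weighted_shift s)) \<le> v m"
    using synth_upper[of "\<lambda>i. weighted_shift r i - weighted_shift s i" "v m"] synth_diff[OF null] by simp
  also have "v m < b m * \<bar>r m - s m\<bar>"
  proof -
    have "\<bar>r m - s m\<bar> > 0" using m(2) by (auto simp: v_def)
    then show ?thesis unfolding v_def using b_gt by (intro mult_strict_right_mono) auto
  qed
  also have "\<dots> \<le> norm (synth r - synth s)" using synth_lower[OF rs, of m] synth_diff[OF r s] by simp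
  finally show ?thesis .
qed

text \<open>The equation determines \<open>r\<close> entry by entry as the partial products of the
  weights, which never drop below 1/2.\<close>

lemma weighted_shift_no_fixed_point:
  assumes r: "r \<longlonglongrightarrow> 0"
  shows "weighted_shift r \<noteq> r"
proof
  assume fix_r: "weighted_shift r = r"
  have r_eq: "r n = (real n + 2) / (2 * (real n + 1))" for n
  proof (induction n)
    case 0 show ?case using fun_cong[OF fix_r, of 0] by (simp add: weighted_shift_def)
  next
    case (Suc n)
    have "r (Suc n) = c0_weight n * r n" using fun_cong[OF fix_r, of "Suc n"] by (simp add: weighted_shift_def)
    also have "\<dots> = (real n + 3) / (2 * (real n + 2))"
    proof -
      have *: "a * c / d\<^sup>2 * (d / (2 * a)) = c / (2 * d)" if "a \<noteq> 0" "d \<noteq> 0" for a c d :: real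
        using that by (simp add: power2_eq_square)
      show ?thesis unfolding Suc.IH c0_weight_eq by (rule *) linarith+
    qed
    finally show ?case by (simp add: add_ac)
  qed
  have "1 / 2 \<le> r n" for n unfolding r_eq by (simp add: field_simps)
  then have "1 / 2 \<le> (0::real)" using LIMSEQ_le_const[OF r] by blast
  then show False by simp
qed

lemma coeffs_unique:
  assumes "r \<longlonglongrightarrow> 0" "s \<longlonglongrightarrow> 0" "synth r = synth s"
  shows "r = s"
  using coeff_dist[OF assms(1,2)] assms(3) by (intro ext) simp

lemma fixed_point_free_contraction:
  obtains f where "f \<in> synth ` unit_coeffs \<rightarrow> synth ` unit_coeffs"
    "\<And>y z. y \<in> synth ` unit_coeffs \<Longrightarrow> z \<in> synth ` unit_coeffs \<Longrightarrow> y \<noteq> z \<Longrightarrow> norm (f y - f z) < norm (y - z)"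
    "\<And>y. y \<in> synth ` unit_coeffs \<Longrightarrow> f y \<noteq> y"
proof -
  define f where "f = (\<lambda>y. synth (weighted_shift (inv_into unit_coeffs synth y)))"
  have null: "r \<longlonglongrightarrow> 0" if "r \<in> unit_coeffs" for r using that by (simp add: unit_coeffs_def)
  have "inj_on synth unit_coeffs" using coeffs_unique null by (auto intro: inj_onI)
  then have f: "f (synth r) = synth (weighted_shift r)" if "r \<in> unit_coeffs" for r
    using that by (simp add: f_def)
  show thesis
  proof (rule that)
    show "f \<in> synth ` unit_coeffs \<rightarrow> synth ` unit_coeffs"
      using weighted_shift_unit_coeffs f by auto
    show "norm (f y - f z) < norm (y - z)"
      if y: "y \<in> synth ` unit_coeffs" and z: "z \<in> synth ` unit_coeffs" and "y \<noteq> z" for y z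
    proof -
      obtain r s where rs: "r \<in> unit_coeffs" "y = synth r" "s \<in> unit_coeffs" "z = synth s"
        using y z by blast
      then have "r \<noteq> s" using \<open>y \<noteq> z\<close> by blast
      from weighted_shift_contractive[OF null[OF rs(1)] null[OF rs(3)] this]
      show ?thesis unfolding rs(2,4) f[OF rs(1)] f[OF rs(3)] .
    qed
    show "f y \<noteq> y" if y: "y \<in> synth ` unit_coeffs" for y
    proof
      assume fix_y: "f y = y"
      obtain r where r: "r \<in> unit_coeffs" "y = synth r" using y by blast
      have "weighted_shift r = r"
        using fix_y f[OF r(1)] r(2) null[OF r(1)] weighted_shift_null by (intro coeffs_unique) simp_all
      then show False using weighted_shift_no_fixed_point[OF null[OF r(1)]] by blast
    qed
  qed
qed

end

section \<open>Existence of the sequence in a nonreflexive subspace\<close>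

text \<open>The lower estimate follows from the upper one by altering coefficients, because the
  \<open>x k\<close> are almost normalised. The factor 3 arises from a convex combination giving the
  auxiliary vector the weight 2/3: up to the factor \<open>\<bar>r k\<bar>\<close>,
  \<open>1 - \<epsilon> k - 2 / 3 = (1 - 3 * \<epsilon> k) / 3\<close> remains for a third of
  \<open>norm y\<close>.\<close>

lemma c0_sequenceI:
  fixes x :: "nat \<Rightarrow> 'a::banach"
  assumes unit: "\<forall>n r. (\<forall>i<n. \<bar>r i\<bar> \<le> 1) \<longrightarrow> norm (\<Sum>i<n. r i *\<^sub>R x i) \<le> 1"
    and norm_x: "\<And>n. 1 - \<epsilon> n < norm (x n)"
    and \<epsilon>: "\<And>n. 0 < \<epsilon> n" "\<And>n. \<epsilon> n \<le> 1 / 8" "\<And>n. c0_weight n < 1 - 3 * \<epsilon> n"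
  shows "c0_sequence x (\<lambda>n. 1 - 3 * \<epsilon> n)"
proof
  show upper: "norm (\<Sum>i<n. r i *\<^sub>R x i) \<le> M" if M: "0 \<le> M" and r: "\<And>i. i < n \<Longrightarrow> \<bar>r i\<bar> \<le> M" for n r M
  proof (cases "M = 0")
    case True then show ?thesis using r by simp
  next
    case False
    have "norm (\<Sum>i<n. (r i / M) *\<^sub>R x i) \<le> 1" using r M False by (intro unit[rule_format]) auto
    moreover have "(\<Sum>i<n. r i *\<^sub>R x i) = M *\<^sub>R (\<Sum>i<n. (r i / M) *\<^sub>R x i)"
      using False by (simp add: scaleR_sum_right)
    ultimately show ?thesis using M by (simp add: mult_left_le)
  qed
  show "(1 - 3 * \<epsilon> k) * \<bar>r k\<bar> \<le> norm (\<Sum>i<n. r i *\<^sub>R x i)" if k: "k < n" for n r k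
  proof -
    define y where "y = (\<Sum>i<n. r i *\<^sub>R x i)"
    have split: "(\<Sum>i<n. (if i = j then c else d * r i) *\<^sub>R x i) = d *\<^sub>R y + (c - d * r j) *\<^sub>R x j"
      if "j < n" for j c d
    proof -
      have "(\<Sum>i<n. (if i = j then c else d * r i) *\<^sub>R x i)
          = (\<Sum>i<n. d *\<^sub>R r i *\<^sub>R x i + (if i = j then (c - d * r j) *\<^sub>R x j else 0))"
        by (intro sum.cong) (auto simp: algebra_simps)
      also have "\<dots> = d *\<^sub>R y + (c - d * r j) *\<^sub>R x j"
        using that by (simp add: sum.distrib y_def scaleR_sum_right)
      finally show ?thesis .
    qed
    define M where "M = Max ((\<lambda>i. \<bar>r i\<bar>) ` {..<n})"
    have "M \<in> (\<lambda>i. \<bar>r i\<bar>) ` {..<n}" unfolding M_def using k by (intro Max_in) auto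
    then obtain j where j: "j < n" "M = \<bar>r j\<bar>" by auto
    have M_ge: "\<bar>r i\<bar> \<le> M" if "i < n" for i using that by (auto simp: M_def)
    \<comment> \<open>Flip every sign except at a largest coefficient:
      \<open>(2 * r j) *\<^sub>R x j - y\<close> still has norm at most \<open>M\<close>, while its
      first term has norm at least \<open>7 / 4 * M\<close>.\<close>
    have "M / 2 \<le> norm y"
    proof -
      have "norm (\<Sum>i<n. (if i = j then r j else - 1 * r i) *\<^sub>R x i) \<le> M"
        using M_ge j by (intro upper) auto
      then have "norm ((2 * r j) *\<^sub>R x j - y) \<le> M" by (subst (asm) split[OF j(1)]) simp
      moreover have "norm ((2 * r j) *\<^sub>R x j) = 2 * (M * norm (x j))" using j by (simp add: abs_mult)
      moreover have "M * (7 / 8) \<le> M * norm (x j)"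
        using norm_x[of j] \<epsilon>(2)[of j] j(2) by (intro mult_left_mono) auto
      moreover have "0 \<le> M" using j(2) by simp
      ultimately show ?thesis using norm_triangle_sub[of "(2 * r j) *\<^sub>R x j" y] by linarith
    qed
    \<comment> \<open>A coefficient of at most half the maximum is covered by the crude bound; for a
      larger one the halved coefficients stay within \<open>\<bar>r k\<bar>\<close>.\<close>
    have "(1 - 3 * \<epsilon> k) * \<bar>r k\<bar> \<le> norm y"
    proof (cases "2 * \<bar>r k\<bar> \<le> M")
      case True
      have "(1 - 3 * \<epsilon> k) * \<bar>r k\<bar> \<le> 1 * \<bar>r k\<bar>" using \<epsilon>(1)[of k] by (intro mult_right_mono) auto
      then show ?thesis using True \<open>M / 2 \<le> norm y\<close> by linarith
    next
      case False
      \<comment> \<open>with \<open>o = y - r\<^sub>k x\<^sub>k\<close>: \<open>r\<^sub>k x\<^sub>k\<close> is the convex combination of \<open>y\<close> and \<open>r\<^sub>k x\<^sub>k - o/2\<close>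
        with weights \<open>1/3\<close> and \<open>2/3\<close>, and the latter has norm at most \<open>\<bar>r\<^sub>k\<bar>\<close>\<close>
      have "norm (\<Sum>i<n. (if i = k then r k else (- 1 / 2) * r i) *\<^sub>R x i) \<le> \<bar>r k\<bar>"
      proof (intro upper)
        fix i assume "i < n"
        then show "\<bar>if i = k then r k else (- 1 / 2) * r i\<bar> \<le> \<bar>r k\<bar>" using M_ge[of i] False by auto
      qed simp
      then have u: "norm ((- 1 / 2) *\<^sub>R y + (3 / 2 * r k) *\<^sub>R x k) \<le> \<bar>r k\<bar>"
        by (subst (asm) split[OF k]) simp
      have "r k *\<^sub>R x k = (1 / 3) *\<^sub>R y + (2 / 3) *\<^sub>R ((- 1 / 2) *\<^sub>R y + (3 / 2 * r k) *\<^sub>R x k)"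
        by (simp add: scaleR_add_right scaleR_diff_right)
      then have "norm (r k *\<^sub>R x k)
          \<le> norm ((1 / 3) *\<^sub>R y) + norm ((2 / 3) *\<^sub>R ((- 1 / 2) *\<^sub>R y + (3 / 2 * r k) *\<^sub>R x k))"
        by (metis norm_triangle_ineq)
      then have "\<bar>r k\<bar> * norm (x k) \<le> norm y / 3 + 2 / 3 * \<bar>r k\<bar>"
        using u unfolding norm_scaleR by simp
      moreover have "\<bar>r k\<bar> * (1 - \<epsilon> k) \<le> \<bar>r k\<bar> * norm (x k)"
        using norm_x[of k] by (intro mult_left_mono) auto
      ultimately show ?thesis by (simp add: algebra_simps)
    qed
    then show ?thesis by (simp add: y_def)
  qed
  show "1 / 2 \<le> 1 - 3 * \<epsilon> k" for k using \<epsilon>(2)[of k] by simp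
qed (rule \<epsilon>(3))

lemma csubspace_imp_subspace: "csubspace (Y :: 'a::complex_normed_vector set) \<Longrightarrow> subspace Y"
  by (auto simp: complex_vector.subspace_def subspace_def scaleR_scaleC)

text \<open>Controlling the finitely many sign combinations collected in \<open>F n\<close>
  suffices: a sum with coefficients in [-1, 1] lies in their convex hull, hence in the unit
  ball.\<close>

lemma nonreflexive_M_embedded_c0_sequence:
  fixes Y :: "'a::complex_banach set" and \<epsilon> :: "nat \<Rightarrow> real"
  assumes emb: "M_embedded (UNIV :: 'a set) norm" and Y: "csubspace Y" "closed Y"
    and nonref: "\<not> reflexive Y norm" and \<epsilon>: "\<And>n. \<epsilon> n > 0"
  obtains x where "\<And>n. x n \<in> Y" "\<And>n. 1 - \<epsilon> n < norm (x n)"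
    "\<forall>n r. (\<forall>i<n. \<bar>r i\<bar> \<le> 1) \<longrightarrow> norm (\<Sum>i<n. r i *\<^sub>R x i) \<le> 1"
proof -
  \<comment> \<open>The clause for \<open>n = 0\<close> pins the start to the empty sum, since the
    choice principle supplies only some state satisfying \<open>P 0\<close>.\<close>
  define P where "P = (\<lambda>(n::nat) (F, x). finite F \<and> F \<subseteq> Y \<and> (\<forall>e\<in>F. norm e < 1) \<and> x \<in> Y \<and>
    (\<forall>e\<in>F. norm (e + x) < 1 \<and> norm (e - x) < 1) \<and> 1 - \<epsilon> n < norm x \<and>
    (n = 0 \<longrightarrow> F = {0}))"
  define Q where "Q = (\<lambda>(n::nat) (F, x::'a) (F', x'::'a).
    F' = (\<lambda>e. x + e) ` F \<union> (\<lambda>e. - x + e) ` F)"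
  have ext: "\<exists>x. P n (F, x)"
    if F: "finite F" "F \<subseteq> Y" "\<And>e. e \<in> F \<Longrightarrow> norm e < 1" "n = 0 \<longrightarrow> F = {0}" for F n
  proof -
    obtain x where "x \<in> Y" "\<And>e. e \<in> F \<Longrightarrow> norm (e + x) < 1" "\<And>e. e \<in> F \<Longrightarrow> norm (e - x) < 1"
      "1 - \<epsilon> n < norm x"
      using M_embedded_block_extension[OF emb Y nonref F(1-3) \<epsilon>[of n]] by metis
    then show ?thesis using F unfolding P_def by auto
  qed
  have "\<exists>f. \<forall>n. P n (f n) \<and> Q n (f n) (f (Suc n))"
  proof (rule dependent_nat_choice)
    show "\<exists>z. P 0 z" using ext[of "{0}" 0] complex_vector.subspace_0[OF Y(1)] by auto
    fix z n assume z: "P n z"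
    obtain F x where Fx: "z = (F, x)" by (cases z)
    let ?F = "(\<lambda>e. x + e) ` F \<union> (\<lambda>e. - x + e) ` F"
    have "\<exists>x'. P (Suc n) (?F, x')"
    proof (rule ext)
      show "finite ?F" using z by (simp add: P_def Fx)
      show "?F \<subseteq> Y"
        using z complex_vector.subspace_add[OF Y(1)] complex_vector.subspace_diff[OF Y(1)]
          complex_vector.subspace_neg[OF Y(1)]
        by (auto simp: P_def Fx)
      show "norm e < 1" if "e \<in> ?F" for e using that z by (auto simp: P_def Fx add.commute)
    qed simp
    then show "\<exists>z'. P (Suc n) z' \<and> Q n z z'" by (auto simp: Q_def Fx)
  qed
  then obtain f where f: "\<And>n. P n (f n)" "\<And>n. Q n (f n) (f (Suc n))" by blast
  define F where "F = fst \<circ> f"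
  define x where "x = snd \<circ> f"
  have Px: "finite (F n)" "\<And>e. e \<in> F n \<Longrightarrow> norm e < 1" "x n \<in> Y" "1 - \<epsilon> n < norm (x n)" for n
    using f(1)[of n] by (auto simp: P_def F_def x_def split: prod.splits)
  have F0: "F 0 = {0}" using f(1)[of 0] by (auto simp: P_def F_def split: prod.splits)
  have F_Suc: "F (Suc n) = (\<lambda>e. x n + e) ` F n \<union> (\<lambda>e. - x n + e) ` F n" for n
    using f(2)[of n] by (simp add: Q_def F_def x_def split: prod.splits)
  have hull: "(\<Sum>i<n. r i *\<^sub>R x i) \<in> convex hull (F n)"
    if "\<And>i. i < n \<Longrightarrow> \<bar>r i\<bar> \<le> 1" for n r
    using that
  proof (induction n)
    case 0 show ?case by (simp add: F0)
  next
    case (Suc n)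
    define p where "p = (\<Sum>i<n. r i *\<^sub>R x i)"
    have p: "p \<in> convex hull (F n)" unfolding p_def using Suc by simp
    have shift: "c + p \<in> convex hull (F (Suc n))" if "(\<lambda>e. c + e) ` F n \<subseteq> F (Suc n)" for c
      using p convex_hull_translation[of c "F n"] hull_mono[OF that] by blast
    have plus: "x n + p \<in> convex hull (F (Suc n))" by (rule shift) (simp add: F_Suc)
    have minus: "- x n + p \<in> convex hull (F (Suc n))" by (rule shift) (simp add: F_Suc)
    have "\<bar>r n\<bar> \<le> 1" using Suc.prems by simp
    \<comment> \<open>The coefficient \<open>r n\<close> is the difference of the convex weights
      given to the two signs of \<open>x n\<close>.\<close>
    then have "((1 + r n) / 2) *\<^sub>R (x n + p) + ((1 - r n) / 2) *\<^sub>R (- x n + p) \<in> convex hull (F (Suc n))"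
      by (intro convexD[OF convex_convex_hull plus minus]) (auto simp: field_simps)
    also have "((1 + r n) / 2) *\<^sub>R (x n + p) + ((1 - r n) / 2) *\<^sub>R (- x n + p)
        = ((1 + r n) / 2 - (1 - r n) / 2) *\<^sub>R x n + ((1 + r n) / 2 + (1 - r n) / 2) *\<^sub>R p"
      by (simp only: scaleR_add_right scaleR_add_left scaleR_diff_left scaleR_minus_right) simp
    also have "\<dots> = p + r n *\<^sub>R x n" by (simp add: field_simps)
    finally show ?case by (simp add: p_def)
  qed
  have ball: "convex hull (F n) \<subseteq> ball 0 1" for n
    using Px(2) by (intro hull_minimal) auto
  show thesis
  proof (rule that[of x])
    show "\<forall>n r. (\<forall>i<n. \<bar>r i\<bar> \<le> 1) \<longrightarrow> norm (\<Sum>i<n. r i *\<^sub>R x i) \<le> 1"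
    proof (intro allI impI)
      fix n and r :: "nat \<Rightarrow> real" assume "\<forall>i<n. \<bar>r i\<bar> \<le> 1"
      then show "norm (\<Sum>i<n. r i *\<^sub>R x i) \<le> 1"
        using subsetD[OF ball hull[of n r]] by simp
    qed
  qed (use Px in auto)
qed

theorem mainTheorem3:
  fixes Y :: "'a::complex_banach set"
  assumes "M_embedded (UNIV :: 'a set) norm"
    and "csubspace Y" and "closed Y"
    and "\<not> reflexive Y norm"
  shows "\<not> fixed_point_property Y"
proof -
  \<comment> \<open>Chosen so that \<open>3 * \<epsilon> n\<close> is three quarters of
    \<open>1 - c0_weight n\<close>, which puts the weight strictly below the constant
    \<open>1 - 3 * \<epsilon> n\<close>.\<close>
  define \<epsilon> where "\<epsilon> = (\<lambda>n. 1 / (4 * (real n + 2)\<^sup>2))"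
  have sq: "(real n + 2)\<^sup>2 \<ge> 4" for n
    using power_mono[of 2 "real n + 2" 2] by simp
  then have sq_pos: "(real n + 2)\<^sup>2 > 0" for n by (rule less_le_trans[rotated]) simp
  have \<epsilon>: "0 < \<epsilon> n" "\<epsilon> n \<le> 1 / 8" "c0_weight n < 1 - 3 * \<epsilon> n" for n
    using sq[of n] sq_pos[of n] by (simp_all add: \<epsilon>_def c0_weight_def field_simps)
  obtain x where x: "\<And>n. x n \<in> Y" "\<And>n. 1 - \<epsilon> n < norm (x n)"
    "\<forall>n r. (\<forall>i<n. \<bar>r i\<bar> \<le> 1) \<longrightarrow> norm (\<Sum>i<n. r i *\<^sub>R x i) \<le> 1"
    by (rule nonreflexive_M_embedded_c0_sequence[of Y \<epsilon>, OF assms \<epsilon>(1)]) (rule that)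
  interpret c0_sequence x "\<lambda>n. 1 - 3 * \<epsilon> n" using x(3,2) \<epsilon> by (rule c0_sequenceI)
  let ?C = "synth ` unit_coeffs"
  obtain f where f: "f \<in> ?C \<rightarrow> ?C"
    "\<And>y z. y \<in> ?C \<Longrightarrow> z \<in> ?C \<Longrightarrow> y \<noteq> z \<Longrightarrow> norm (f y - f z) < norm (y - z)"
    "\<And>y. y \<in> ?C \<Longrightarrow> f y \<noteq> y"
    using fixed_point_free_contraction by metis
  have "(\<lambda>_. 0) \<in> unit_coeffs" by (simp add: unit_coeffs_def)
  then have "?C \<noteq> {}" by blast
  moreover have "?C \<subseteq> Y"
    using csubspace_imp_subspace[OF assms(2)] assms(3) x(1) by (rule synth_image_subset)
  moreover have "contractive_on ?C f" using f(2) by (simp add: contractive_on_def)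
  ultimately have *: "?C \<subseteq> Y \<and> ?C \<noteq> {} \<and> closed ?C \<and> bounded ?C \<and> convex ?C \<and>
      f \<in> ?C \<rightarrow> ?C \<and> contractive_on ?C f"
    using closed_synth_image bounded_synth_image convex_synth_image f(1) by (intro conjI)
  show ?thesis
  proof
    assume "fixed_point_property Y"
    then have "\<exists>y\<in>?C. f y = y"
      unfolding fixed_point_property_def using * by (elim allE[of _ ?C] allE[of _ f] mp)
    then show False using f(3) by blast
  qed
qed

end
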